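(* Let $0<q<1$ and let $\alpha,\beta,\delta$ be complex parameters. For $0\leq n\leq N$ set $$r_n(x;\alpha,\beta,\delta,n;q)=(\alpha\beta q^{n+1})^x\frac{(\alpha^{-1}\delta q^{-n},\beta^{-1}q^{-n};q)_x}{(\alpha q,\beta\delta q;q)_x},\qquad x=0,1,\dotsc,n,$$ and $$r_n(x;\alpha,\beta,\delta,N;q)=\frac{(q;q)_n}{(q;q)_N}q^{(N-n)(N+n+1)/2}\,\mathcal{R}_{N-1}\mathcal{R}_{N-2}\cdots \mathcal{R}_n\,r_n(x;\alpha,\beta,\delta,n;q),\qquad x=0,1,\dotsc,N.$$ Then we have the explicit formula $$r_n(x;\alpha,\beta,\delta,N;q)=\frac{(q;q)_n}{(q^{N-n+1};q)_n}\sum_{y=\max(x-N+n,0)}^{\min(x,n)}\begin{bmatrix}N-x\\ n-y\end{bmatrix}_q\begin{bmatrix}x\\ y\end{bmatrix}_q\frac{(\delta q^{x-N};q)_y(\delta q^{x-n+y+1};q)_{n-y}}{(\delta q^{y-n};q)_{n+1}}(1-\delta q^{2y-n})\,q^{y(y+N-x-n)}(\alpha\beta q^{n+1})^y\frac{(\alpha^{-1}\delta q^{-n},\beta^{-1}q^{-n};q)_y}{(\alpha q,\beta\delta q;q)_y}.$$ Moreover, the functions $r_n(\cdot;\alpha,\beta,\delta,N;q)$ satisfy the $q$-difference equation $$\mathcal{D}_Nr_n(x;\alpha,\beta,\delta,N;q)=q^{-n}(1-q^n)(1-\alpha\beta q^{n+1})\,r_n(x;\alpha,\beta,\delta,N;q),$$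 and the orthogonality relations $$\langle r_n(\cdot;\alpha,\beta,\delta,N;q),r_m(\cdot;\alpha,\beta,\delta,N;q)\rangle_{V_N}=\delta_{n,m}\,q^{N(N+1)/2}(\delta q^{-N})^n\frac{(\alpha\beta q^{n+1};q)_{N+1}(q,\alpha\delta^{-1}q,\beta q;q)_n}{(1-\alpha\beta q^{2n+1})(q;q)_N(q^{-N},\beta\delta q,\alpha q;q)_n}.$$
   Context: Notation: $(a;q)_k=\prod_{i=0}^{k-1}(1-aq^i)$, $(a_1,\dots,a_r;q)_k=\prod_i (a_i;q)_k$, $\begin{bmatrix}n\\ k\end{bmatrix}_q=\frac{(q^{n-k+1};q)_k}{(q;q)_k}$ for $0\le k\le n$; $\delta_{n,m}$ is the Kronecker symbol (distinct from the parameter $\delta$). $V_N$ is the space of functions $f:\{0,1,\dotsc,N\}\to\mathbb{C}$, with the convention $f(-1)=f(N+1)=0$, endowed with the scalar product $$\langle f_1,f_2\rangle_{V_N}=q^{N(N+1)/2}\frac{(\alpha\delta^{-1}q,\beta q;q)_N}{(q,\delta^{-1};q)_N}\sum_{x=0}^N\frac{(\alpha q,\beta\delta q, q^{-N},\delta q^{-N};q)_x}{(q,\alpha^{-1}\delta q^{-N},\beta^{-1}q^{-N},\delta q;q)_x}\cdot\frac{1-\delta q^{2x-N}}{(\alpha\beta q)^x(1-\delta q^{-N})}f_1(x)\overline{f_2(x)},$$ or, equivalently, $$\langle f_1,f_2\rangle_{V_N}=\sum_{x=0}^N\frac{(\alpha q,\beta^{-1}\delta^{-1} q^{-x};q)_x(\beta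 q,\alpha\delta^{-1}q;q)_{N-x}} {(q;q)_x(q;q)_{N-x}(\delta^{-1} q^{-x};q)_{N+1}}\,\beta^x q^{N(N+1)/2+x}(1-\delta^{-1} q^{N-2x})f_1(x)\overline{f_2(x)}.$$ $\mathcal{R}_k:V_k\to V_{k+1}$ is $$\mathcal{R}_k f(x)=-\frac{(1-q^{x-k-1})(1-\delta q^{x-k-1})}{1-\delta q^{2x-k-1}}f(x)+\frac{q^{-k-1}(1-q^x)(1-\delta q^x)}{1-\delta q^{2x-k-1}}f(x-1)$$ (the empty product of operators, for $n=N$, is the identity). The $q$-Racah operator is $\mathcal{D}_Nf(x)=B_N(x)f(x+1)-[B_N(x)+D_N(x)]f(x)+D_N(x)f(x-1)$ on $V_N$, with $$B_N(x)=\frac{(1-\alpha q^{x+1})(1-\beta\delta q^{x+1})(1- q^{x-N})(1-\delta q^{x-N})}{(1-\delta q^{2x-N})(1-\delta q^{2x-N+1})},\quad D_N(x)=\frac{(\alpha-\delta q^{x-N-1})(\beta q^{N+2} - q^{x+1})(1-q^x)(1-\delta q^x)q^{-N-1}}{(1-\delta q^{2x-N})(1-\delta q^{2x-N-1})}.$$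
   Formalization: The orthogonality as written fails for non-real parameters; it is proved for real α, β, δ, and for complex ones without the conjugation of r_m. All denominators are assumed nonzero: α, β, δ ≠ 0; αq^j, βδq^j ≠ 1 (1≤j≤N); δq^j ≠ 1 (|j|≤N); for orthogonality αβq^{2n+1} ≠ 1. *)

theory Defs
  imports "HOL-Analysis.Analysis"
begin

definition qpoch :: "complex \<Rightarrow> complex \<Rightarrow> nat \<Rightarrow> complex" where
  "qpoch a q k = (\<Prod>i<k. 1 - a * q ^ i)"

definition qbinom :: "complex \<Rightarrow> nat \<Rightarrow> nat \<Rightarrow> complex" where
  "qbinom q n k = qpoch (q ^ (n - k + 1)) q k / qpoch q q k"

text \<open>
  A function on \<open>{0..N}\<close> is represented by a function on \<open>nat\<close> of which only the values at
  \<open>x \<le> N\<close> matter. \<open>val N f\<close> reads it at an integer point, with value 0 outside \<open>{0..N}\<close>;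
  this is the convention \<open>f(-1) = f(N+1) = 0\<close>.
\<close>

definition val :: "nat \<Rightarrow> (nat \<Rightarrow> complex) \<Rightarrow> int \<Rightarrow> complex" where
  "val N f i = (if 0 \<le> i \<and> i \<le> int N then f (nat i) else 0)"

text \<open>
  Of the two equivalent expressions for the scalar product this is the one whose denominators
  vanish for fewer parameters; the other one is \<open>inner_V_alt\<close>, and
  \<open>inner_V_eq_inner_V_alt\<close> shows that they agree wherever both make sense.
\<close>

definition weight :: "complex \<Rightarrow> complex \<Rightarrow> complex \<Rightarrow> nat \<Rightarrow> complex \<Rightarrow> nat \<Rightarrow> complex" where
  "weight \<alpha> \<beta> \<delta> N q x =
     qpoch (\<alpha> * q) q x * qpoch (inverse \<beta> * inverse \<delta> * q powi (- int x)) q x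
     * qpoch (\<beta> * q) q (N - x) * qpoch (\<alpha> * inverse \<delta> * q) q (N - x)
     / (qpoch q q x * qpoch q q (N - x) * qpoch (inverse \<delta> * q powi (- int x)) q (N + 1))
     * \<beta> ^ x * q ^ (N * (N + 1) div 2 + x) * (1 - inverse \<delta> * q powi (int N - 2 * int x))"

definition inner_V :: "complex \<Rightarrow> complex \<Rightarrow> complex \<Rightarrow> nat \<Rightarrow> complex
    \<Rightarrow> (nat \<Rightarrow> complex) \<Rightarrow> (nat \<Rightarrow> complex) \<Rightarrow> complex" where
  "inner_V \<alpha> \<beta> \<delta> N q f g = (\<Sum>x=0..N. weight \<alpha> \<beta> \<delta> N q x * f x * cnj (g x))"

definition raising :: "complex \<Rightarrow> complex \<Rightarrow> nat \<Rightarrow> (nat \<Rightarrow> complex) \<Rightarrow> nat \<Rightarrow> complex" where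
  "raising \<delta> q k f x =
     - ((1 - q powi (int x - int k - 1)) * (1 - \<delta> * q powi (int x - int k - 1))
        / (1 - \<delta> * q powi (2 * int x - int k - 1))) * val k f (int x)
     + q powi (- int k - 1) * (1 - q ^ x) * (1 - \<delta> * q ^ x)
        / (1 - \<delta> * q powi (2 * int x - int k - 1)) * val k f (int x - 1)"

definition racah_B :: "complex \<Rightarrow> complex \<Rightarrow> complex \<Rightarrow> nat \<Rightarrow> complex \<Rightarrow> nat \<Rightarrow> complex" where
  "racah_B \<alpha> \<beta> \<delta> N q x =
     (1 - \<alpha> * q ^ (x + 1)) * (1 - \<beta> * \<delta> * q ^ (x + 1))
     * (1 - q powi (int x - int N)) * (1 - \<delta> * q powi (int x - int N))
     / ((1 - \<delta> * q powi (2 * int x - int N)) * (1 - \<delta> * q powi (2 * int x - int N + 1)))"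

definition racah_D :: "complex \<Rightarrow> complex \<Rightarrow> complex \<Rightarrow> nat \<Rightarrow> complex \<Rightarrow> nat \<Rightarrow> complex" where
  "racah_D \<alpha> \<beta> \<delta> N q x =
     (\<alpha> - \<delta> * q powi (int x - int N - 1)) * (\<beta> * q ^ (N + 2) - q ^ (x + 1))
     * (1 - q ^ x) * (1 - \<delta> * q ^ x) * q powi (- int N - 1)
     / ((1 - \<delta> * q powi (2 * int x - int N)) * (1 - \<delta> * q powi (2 * int x - int N - 1)))"

definition racah_op :: "complex \<Rightarrow> complex \<Rightarrow> complex \<Rightarrow> nat \<Rightarrow> complex
    \<Rightarrow> (nat \<Rightarrow> complex) \<Rightarrow> nat \<Rightarrow> complex" where
  "racah_op \<alpha> \<beta> \<delta> N q f x =
     racah_B \<alpha> \<beta> \<delta> N q x * val N f (int x + 1)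
     - (racah_B \<alpha> \<beta> \<delta> N q x + racah_D \<alpha> \<beta> \<delta> N q x) * val N f (int x)
     + racah_D \<alpha> \<beta> \<delta> N q x * val N f (int x - 1)"

definition r_diag :: "nat \<Rightarrow> complex \<Rightarrow> complex \<Rightarrow> complex \<Rightarrow> complex \<Rightarrow> nat \<Rightarrow> complex" where
  "r_diag n \<alpha> \<beta> \<delta> q x =
     (\<alpha> * \<beta> * q ^ (n + 1)) ^ x
     * (qpoch (inverse \<alpha> * \<delta> * q powi (- int n)) q x * qpoch (inverse \<beta> * q powi (- int n)) q x)
     / (qpoch (\<alpha> * q) q x * qpoch (\<beta> * \<delta> * q) q x)"

text \<open>
  The \<open>fold\<close> is the composition \<open>R\<^sub>N\<^sub>-\<^sub>1 \<circ> \<dots> \<circ> R\<^sub>n\<close> (first \<open>R\<^sub>n\<close>, last \<open>R\<^sub>N\<^sub>-\<^sub>1\<close>); it is the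
  identity for \<open>n = N\<close>.
\<close>

definition r_fun :: "nat \<Rightarrow> complex \<Rightarrow> complex \<Rightarrow> complex \<Rightarrow> nat \<Rightarrow> complex \<Rightarrow> nat \<Rightarrow> complex" where
  "r_fun n \<alpha> \<beta> \<delta> N q x =
     qpoch q q n / qpoch q q N * q ^ ((N - n) * (N + n + 1) div 2)
     * fold (raising \<delta> q) [n..<N] (r_diag n \<alpha> \<beta> \<delta> q) x"

lemma qpoch_0 [simp]: "qpoch a q 0 = 1"
  by (simp add: qpoch_def)

lemma qpoch_Suc: "qpoch a q (Suc k) = qpoch a q k * (1 - a * q ^ k)"
  by (simp add: qpoch_def)

lemma qpoch_Suc_shift: "qpoch a q (Suc k) = (1 - a) * qpoch (a * q) q k"
  unfolding qpoch_def by (subst prod.lessThan_Suc_shift) (simp add: mult.assoc)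

lemma qpoch_nonzero: "(\<And>i. i < k \<Longrightarrow> a * q ^ i \<noteq> 1) \<Longrightarrow> qpoch a q k \<noteq> 0"
  by (auto simp: qpoch_def)

definition weight_alt :: "complex \<Rightarrow> complex \<Rightarrow> complex \<Rightarrow> nat \<Rightarrow> complex \<Rightarrow> nat \<Rightarrow> complex" where
  "weight_alt \<alpha> \<beta> \<delta> N q x =
     q ^ (N * (N + 1) div 2)
     * (qpoch (\<alpha> * inverse \<delta> * q) q N * qpoch (\<beta> * q) q N) / (qpoch q q N * qpoch (inverse \<delta>) q N)
     * ((qpoch (\<alpha> * q) q x * qpoch (\<beta> * \<delta> * q) q x
          * qpoch (q powi (- int N)) q x * qpoch (\<delta> * q powi (- int N)) q x)
        / (qpoch q q x * qpoch (inverse \<alpha> * \<delta> * q powi (- int N)) q x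
          * qpoch (inverse \<beta> * q powi (- int N)) q x * qpoch (\<delta> * q) q x)
        * ((1 - \<delta> * q powi (2 * int x - int N))
           / ((\<alpha> * \<beta> * q) ^ x * (1 - \<delta> * q powi (- int N)))))"

lemma weight_eq_weight_alt:
  fixes q \<alpha> \<beta> \<delta> :: complex and N x :: nat
  assumes q0: "q \<noteq> 0" and q1: "\<And>j. j \<ge> 1 \<Longrightarrow> q ^ j \<noteq> 1"
    and nz: "\<alpha> \<noteq> 0" "\<beta> \<noteq> 0" "\<delta> \<noteq> 0"
    and d: "\<And>j::int. \<bar>j\<bar> \<le> int N \<Longrightarrow> \<delta> * q powi j \<noteq> 1"
    and b: "\<And>j. 1 \<le> j \<Longrightarrow> j \<le> N \<Longrightarrow> \<beta> * q ^ j \<noteq> 1"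
    and ad: "\<And>j. 1 \<le> j \<Longrightarrow> j \<le> N \<Longrightarrow> \<alpha> * inverse \<delta> * q ^ j \<noteq> 1"
    and x: "x \<le> N"
  shows "weight \<alpha> \<beta> \<delta> N q x = weight_alt \<alpha> \<beta> \<delta> N q x"
  using x
proof (induction x)
  case 0
  have "\<delta> * q powi int N \<noteq> 1" "\<delta> * q powi (- int N) \<noteq> 1" by (intro d; simp)+
  hence "1 - \<delta> * q powi (- int N) \<noteq> 0" "1 - inverse \<delta> * q ^ N \<noteq> 0"
    using nz q0 by (auto simp: field_simps power_int_minus)
  thus ?case
    by (simp add: weight_def weight_alt_def qpoch_Suc)
next
  case (Suc x)
  hence xN: "x < N" by simp
  obtain k where k: "N = Suc (x + k)" using xN less_iff_Suc_add by auto
  define p where "p = q ^ x"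
  define s where "s = q ^ Suc k"
  have p0: "p \<noteq> 0" and s0: "s \<noteq> 0" using q0 by (auto simp: p_def s_def)
  have qN: "q ^ N = p * s" by (simp add: k p_def s_def power_add)
  have qNi: "q powi (- int N) = 1 / (p * s)" by (simp add: power_int_minus qN field_simps)
  have e1: "q powi (- int x) = 1 / p" by (simp add: p_def power_int_minus field_simps)
  have e2: "q powi (- int (Suc x)) = 1 / (p * q)"
    unfolding power_int_minus power_int_of_nat by (simp add: p_def field_simps)
  have e3: "q powi (int N - 2 * int x) = s / p"
  proof -
    have "int N - 2 * int x = int (Suc k) - int x" by (simp add: k)
    thus ?thesis by (simp only: power_int_diff[OF disjI1[OF q0]] power_int_of_nat p_def s_def)
  qed
  have e4: "q powi (int N - 2 * int (Suc x)) = s / (p * q ^ 2)"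
  proof -
    have "int N - 2 * int (Suc x) = (int N - 2 * int x) - 2" by simp
    thus ?thesis using e3 q0 by (simp only: power_int_diff[OF disjI1[OF q0]]) simp
  qed
  have e5: "q powi (2 * int x - int N) = p / s"
  proof -
    have "2 * int x - int N = int x - int (Suc k)" by (simp add: k)
    thus ?thesis by (simp only: power_int_diff[OF disjI1[OF q0]] power_int_of_nat p_def s_def)
  qed
  have e6: "q powi (2 * int (Suc x) - int N) = p * q ^ 2 / s"
  proof -
    have "2 * int (Suc x) - int N = (2 * int x - int N) + 2" by simp
    thus ?thesis using e5 q0 by (simp only: power_int_add[OF disjI1[OF q0]]) simp
  qed
  have Nx: "N - x = Suc k" "N - Suc x = k" by (auto simp: k)
  have sk: "q ^ k = s / q" using q0 by (simp add: s_def)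

  have n1: "1 - \<delta> * (p / s) \<noteq> 0" using d[of "2 * int x - int N"] xN by (simp add: e5)
  have n2: "1 - \<delta> * (p * q) \<noteq> 0"
    using d[of "int (Suc x)"] xN by (simp only: power_int_of_nat) (simp add: p_def mult_ac)
  have n3: "1 - \<beta> * s \<noteq> 0" using b[of "Suc k"] k by (simp add: s_def)
  have n4: "1 - \<alpha> * inverse \<delta> * s \<noteq> 0" using ad[of "Suc k"] k by (simp add: s_def)
  have n5: "1 - s \<noteq> 0" using q1[of "Suc k"] by (simp add: s_def)
  have n6: "1 - q * p \<noteq> 0" using q1[of "Suc x"] by (simp add: p_def)
  have n7: "1 - inverse \<delta> * s \<noteq> 0"
  proof -
    have "\<delta> * q powi int (Suc k) \<noteq> 1" "\<delta> * q powi (- int (Suc k)) \<noteq> 1" by (rule d; simp add: k)+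
    thus ?thesis unfolding power_int_minus power_int_of_nat s_def[symmetric]
      using nz s0 by (auto simp: field_simps)
  qed
  have n8: "qpoch (inverse \<delta> * (1 / p)) q N \<noteq> 0"
  proof (rule qpoch_nonzero)
    fix i assume i: "i < N"
    have "\<delta> * q powi (int x - int i) \<noteq> 1" by (rule d) (use xN i in simp)
    moreover have "q powi (int x - int i) = p / q ^ i"
      by (simp only: power_int_diff[OF disjI1[OF q0]] power_int_of_nat p_def)
    ultimately show "inverse \<delta> * (1 / p) * q ^ i \<noteq> 1"
      using nz p0 q0 by (auto simp: field_simps)
  qed

  define u where "u = qpoch (inverse \<delta> * (1 / p)) q N"
  have u0: "u \<noteq> 0" using n8 by (simp add: u_def)
  have qp: "qpoch q q x \<noteq> 0" "qpoch q q k \<noteq> 0"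
    using q1[of "Suc _"] by (auto intro!: qpoch_nonzero)
  define f1 where "f1 = 1 - \<alpha> * q * p"
  define f2 where "f2 = 1 - \<beta> * \<delta> * q * p"
  define f3 where "f3 = 1 - s"
  define f4 where "f4 = 1 - inverse \<delta> * s"
  define f5 where "f5 = 1 - \<delta> * (p * q ^ 2 / s)"
  define g1 where "g1 = 1 - q * p"
  define g2 where "g2 = 1 - \<alpha> * inverse \<delta> * s"
  define g3 where "g3 = 1 - \<beta> * s"
  define g4 where "g4 = 1 - \<delta> * (p * q)"
  define g5 where "g5 = 1 - \<delta> * (p / s)"
  have fg: "f3 \<noteq> 0" "f4 \<noteq> 0" "g1 \<noteq> 0" "g2 \<noteq> 0" "g3 \<noteq> 0" "g4 \<noteq> 0" "g5 \<noteq> 0"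
    using n1 n2 n3 n4 n5 n6 n7 by (auto simp: f3_def f4_def g1_def g2_def g3_def g4_def g5_def)
  define R where "R = f1 * f2 * f3 * f4 * f5 / (g1 * g2 * g3 * g4 * g5 * q)"

  have A1: "qpoch (\<alpha> * q) q (Suc x) = qpoch (\<alpha> * q) q x * f1"
    by (simp add: qpoch_Suc f1_def p_def)
  have A2: "qpoch q q (Suc x) = qpoch q q x * g1"
    by (simp add: qpoch_Suc g1_def p_def)

  have B1: "qpoch (inverse \<beta> * inverse \<delta> * (1 / (p * q))) q (Suc x)
      = - f2 / (\<beta> * \<delta> * p * q) * qpoch (inverse \<beta> * inverse \<delta> * (1 / p)) q x"
  proof -
    have "inverse \<beta> * inverse \<delta> * (1 / (p * q)) * q = inverse \<beta> * inverse \<delta> * (1 / p)"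
      using q0 by simp
    moreover have "1 - inverse \<beta> * inverse \<delta> * (1 / (p * q)) = - f2 / (\<beta> * \<delta> * p * q)"
      using q0 p0 nz by (simp add: f2_def field_simps)
    ultimately show ?thesis by (simp only: qpoch_Suc_shift)
  qed
  have B2: "qpoch (\<beta> * q) q (Suc k) = qpoch (\<beta> * q) q k * g3"
    by (simp add: qpoch_Suc g3_def s_def)
  have B3: "qpoch (\<alpha> * inverse \<delta> * q) q (Suc k) = qpoch (\<alpha> * inverse \<delta> * q) q k * g2"
    by (simp add: qpoch_Suc g2_def s_def)
  have B4: "qpoch q q (Suc k) = qpoch q q k * f3"
    by (simp add: qpoch_Suc f3_def s_def)
  have B5: "qpoch (inverse \<delta> * (1 / (p * q))) q (N + 1) = - g4 / (\<delta> * p * q) * u"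
  proof -
    have "inverse \<delta> * (1 / (p * q)) * q = inverse \<delta> * (1 / p)"
      using q0 by simp
    moreover have "1 - inverse \<delta> * (1 / (p * q)) = - g4 / (\<delta> * p * q)"
      using q0 p0 nz by (simp add: g4_def field_simps)
    ultimately show ?thesis by (simp only: qpoch_Suc_shift u_def flip: Suc_eq_plus1)
  qed
  have B6: "qpoch (inverse \<delta> * (1 / p)) q (N + 1) = u * f4"
    using p0 by (simp add: qpoch_Suc u_def f4_def qN)
  have B7: "1 - inverse \<delta> * (s / (p * q\<^sup>2)) = - f5 * s / (\<delta> * p * q\<^sup>2)"
    using p0 s0 q0 nz by (simp add: f5_def field_simps)
  have B8: "1 - inverse \<delta> * (s / p) = - g5 * s / (\<delta> * p)"
    using p0 s0 q0 nz by (simp add: g5_def field_simps)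
  have B9: "q ^ (N * (N + 1) div 2 + Suc x) = q ^ (N * (N + 1) div 2 + x) * q" by simp
  have B10: "\<beta> ^ Suc x = \<beta> ^ x * \<beta>" by simp

  have W: "weight \<alpha> \<beta> \<delta> N q (Suc x) = weight \<alpha> \<beta> \<delta> N q x * R"
    unfolding weight_def e1 e2 e3 e4 Nx A1 A2 B1 B2 B3 B4 B5 B6 B7 B8 B9 B10 R_def
    using fg p0 s0 q0 nz qp u0 by (simp add: divide_simps power2_eq_square)

  have C1: "qpoch (\<beta> * \<delta> * q) q (Suc x) = qpoch (\<beta> * \<delta> * q) q x * f2"
    by (simp add: qpoch_Suc f2_def p_def)
  have C2: "qpoch (1 / (p * s)) q (Suc x) = qpoch (1 / (p * s)) q x * (- f3 / s)"
    using p0 s0 by (simp add: qpoch_Suc f3_def flip: p_def) (simp add: field_simps)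
  have C3: "qpoch (\<delta> * (1 / (p * s))) q (Suc x) = qpoch (\<delta> * (1 / (p * s))) q x * (- \<delta> * f4 / s)"
    using p0 s0 nz by (simp add: qpoch_Suc f4_def flip: p_def) (simp add: field_simps)
  have C4: "qpoch (inverse \<alpha> * \<delta> * (1 / (p * s))) q (Suc x)
      = qpoch (inverse \<alpha> * \<delta> * (1 / (p * s))) q x * (- \<delta> * g2 / (\<alpha> * s))"
    using p0 s0 nz by (simp add: qpoch_Suc g2_def flip: p_def) (simp add: field_simps)
  have C5: "qpoch (inverse \<beta> * (1 / (p * s))) q (Suc x)
      = qpoch (inverse \<beta> * (1 / (p * s))) q x * (- g3 / (\<beta> * s))"
    using p0 s0 nz by (simp add: qpoch_Suc g3_def flip: p_def) (simp add: field_simps)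
  have C6: "qpoch (\<delta> * q) q (Suc x) = qpoch (\<delta> * q) q x * g4"
    by (simp add: qpoch_Suc g4_def p_def mult_ac)
  have C7: "(\<alpha> * \<beta> * q) ^ Suc x = (\<alpha> * \<beta> * q) ^ x * (\<alpha> * \<beta> * q)" by simp
  have C8: "1 - \<delta> * (p * q\<^sup>2 / s) = f5" "1 - \<delta> * (p / s) = g5"
    by (simp_all add: f5_def g5_def)

  have step: "c * ((a1 * f1 * (a2 * f2) * (a3 * (- f3 / s)) * (a4 * (- \<delta> * f4 / s)))
        / (b1 * g1 * (b2 * (- \<delta> * g2 / (\<alpha> * s))) * (b3 * (- g3 / (\<beta> * s))) * (b4 * g4))
        * (f5 / (t * (\<alpha> * \<beta> * q) * z)))
      = c * ((a1 * a2 * a3 * a4) / (b1 * b2 * b3 * b4) * (g5 / (t * z))) * R"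
    for c a1 a2 a3 a4 b1 b2 b3 b4 t z :: complex
    unfolding R_def using fg s0 q0 nz by (simp add: divide_simps)
  have W': "weight_alt \<alpha> \<beta> \<delta> N q (Suc x) = weight_alt \<alpha> \<beta> \<delta> N q x * R"
    unfolding weight_alt_def e5 e6 qNi A1 A2 C1 C2 C3 C4 C5 C6 C7 C8 by (rule step)
  from xN have IH: "weight \<alpha> \<beta> \<delta> N q x = weight_alt \<alpha> \<beta> \<delta> N q x" by (intro Suc.IH) simp
  show ?case by (simp only: W W' IH)
qed

definition inner_V_alt :: "complex \<Rightarrow> complex \<Rightarrow> complex \<Rightarrow> nat \<Rightarrow> complex
    \<Rightarrow> (nat \<Rightarrow> complex) \<Rightarrow> (nat \<Rightarrow> complex) \<Rightarrow> complex" where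
  "inner_V_alt \<alpha> \<beta> \<delta> N q f g = (\<Sum>x=0..N. weight_alt \<alpha> \<beta> \<delta> N q x * f x * cnj (g x))"

lemma inner_V_eq_inner_V_alt:
  fixes q \<alpha> \<beta> \<delta> :: complex and N :: nat
  assumes "q \<noteq> 0" "\<And>j. j \<ge> 1 \<Longrightarrow> q ^ j \<noteq> 1"
    and "\<alpha> \<noteq> 0" "\<beta> \<noteq> 0" "\<delta> \<noteq> 0"
    and "\<And>j::int. \<bar>j\<bar> \<le> int N \<Longrightarrow> \<delta> * q powi j \<noteq> 1"
    and "\<And>j. 1 \<le> j \<Longrightarrow> j \<le> N \<Longrightarrow> \<beta> * q ^ j \<noteq> 1"
    and "\<And>j. 1 \<le> j \<Longrightarrow> j \<le> N \<Longrightarrow> \<alpha> * inverse \<delta> * q ^ j \<noteq> 1"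
  shows "inner_V \<alpha> \<beta> \<delta> N q f g = inner_V_alt \<alpha> \<beta> \<delta> N q f g"
  unfolding inner_V_def inner_V_alt_def
  by (rule sum.cong[OF refl]) (simp add: weight_eq_weight_alt[OF assms])

end

(* The operator D_N factors through a lowering operator L : V_(N+1) -> V_N: one has
   D_(N+1) = R_N L + c_(N+1) and L R_N = D_N - c_(N+1), where c_n is the eigenvalue claimed for r_n.
   Hence R_N intertwines D_N with D_(N+1), and since L annihilates the functions r_n in V_n, these and
   all their images under the R_k are eigenfunctions.  With respect to the bilinear form of V_N,
   R_N is minus the adjoint of L, so <R f, R g> = <f, (c_(N+1) - D_N) g>.  This reduces
   orthogonality and norms to the case N = n without requiring distinct eigenvalues.  For N = n
   the weight times r_n^2 is a multiple of the weight with parameters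
   (alpha', beta') = (delta/(alpha q^(n+1)), 1/(beta delta q^(n+1))), whose total mass follows from the
   same recursion applied to the constant function.  In the explicit formula, the coefficient of each
   value r_n(y; alpha, beta, delta, n) satisfies the recursion given by R_N separately. *)

theory Submission
  imports Defs
begin

text \<open>The factorisations close because R and L both send the constant function 1 to a
  constant. Since D annihilates constants, the product of these two constants is minus the
  eigenvalue in the factorisation, and the diagonal coefficients follow from the off-diagonal ones.
  For complex parameters the weight is complex and L has complex coefficients, so the adjoint
  relation calls for a symmetric bilinear form. Conjugation returns only at the end: either a second
  conjugation cancels it, or the parameters are real and it fixes r_n. The delicate points are the
  ends of {0..N}, where functions are read outside their domain. There one of the coefficients of R
  vanishes (that of f(x) at x = k + 1, that of f(x - 1) at x = 0), so the identities can be stated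
  for functions on all of \<open>nat\<close> and summation by parts has no boundary terms.\<close>

definition raise_u :: "complex \<Rightarrow> complex \<Rightarrow> nat \<Rightarrow> nat \<Rightarrow> complex" where
  "raise_u \<delta> q k x = - ((1 - q powi (int x - int k - 1)) * (1 - \<delta> * q powi (int x - int k - 1))
     / (1 - \<delta> * q powi (2 * int x - int k - 1)))"

definition raise_v :: "complex \<Rightarrow> complex \<Rightarrow> nat \<Rightarrow> nat \<Rightarrow> complex" where
  "raise_v \<delta> q k x = q powi (- int k - 1) * (1 - q ^ x) * (1 - \<delta> * q ^ x)
     / (1 - \<delta> * q powi (2 * int x - int k - 1))"

text \<open>The coefficients of L are what remains of the q-Racah coefficients after splitting off
  those of R_k. With u, v for \<open>raise_u\<close>, \<open>raise_v\<close> and a, c for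
  \<open>lower_a\<close>, \<open>lower_c\<close>, level \<open>k + 1\<close> has B(x) = u(x) a(x)
  and D(x + 1) = v(x + 1) c(x). The same functions in the other order give level \<open>k\<close>:
  B(x) = a(x) u(x + 1) and D(x) = c(x) v(x).\<close>

definition lower_a :: "complex \<Rightarrow> complex \<Rightarrow> complex \<Rightarrow> complex \<Rightarrow> nat \<Rightarrow> nat \<Rightarrow> complex" where
  "lower_a \<alpha> \<beta> \<delta> q k x = - ((1 - \<alpha> * q ^ (x + 1)) * (1 - \<beta> * \<delta> * q ^ (x + 1))
     / (1 - \<delta> * q powi (2 * int x - int k)))"

definition lower_c :: "complex \<Rightarrow> complex \<Rightarrow> complex \<Rightarrow> complex \<Rightarrow> nat \<Rightarrow> nat \<Rightarrow> complex" where
  "lower_c \<alpha> \<beta> \<delta> q k x = (\<alpha> - \<delta> * q powi (int x - int k - 1)) * (\<beta> * q ^ (k + 2) - q ^ (x + 1))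
     / (1 - \<delta> * q powi (2 * int x - int k))"

definition lowering :: "complex \<Rightarrow> complex \<Rightarrow> complex \<Rightarrow> complex \<Rightarrow> nat
    \<Rightarrow> (nat \<Rightarrow> complex) \<Rightarrow> nat \<Rightarrow> complex" where
  "lowering \<alpha> \<beta> \<delta> q k f x = lower_a \<alpha> \<beta> \<delta> q k x * f (Suc x) + lower_c \<alpha> \<beta> \<delta> q k x * f x"

text \<open>The exponents from - N to N cover the \<delta>-denominators of the weight on V_N and
  those of R_k and L for k < N at the points where they act. The condition passes to smaller N, as
  the inductions on the level require.\<close>

definition regular :: "complex \<Rightarrow> complex \<Rightarrow> nat \<Rightarrow> bool" where
  "regular \<delta> q N \<longleftrightarrow> q \<noteq> 0 \<and> (\<forall>j. q ^ Suc j \<noteq> 1) \<and> \<delta> \<noteq> 0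
     \<and> (\<forall>j::int. \<bar>j\<bar> \<le> int N \<longrightarrow> \<delta> * q powi j \<noteq> 1)"

definition racah_eigenvalue :: "complex \<Rightarrow> complex \<Rightarrow> complex \<Rightarrow> nat \<Rightarrow> complex" where
  "racah_eigenvalue \<alpha> \<beta> q n = q powi (- int n) * (1 - q ^ n) * (1 - \<alpha> * \<beta> * q ^ (n + 1))"

lemma regular_antimono: "regular \<delta> q N \<Longrightarrow> M \<le> N \<Longrightarrow> regular \<delta> q M"
  unfolding regular_def by (meson of_nat_mono order_trans)

lemma regularD:
  assumes "regular \<delta> q N"
  shows "q \<noteq> 0" "q ^ Suc j \<noteq> 1" "\<delta> \<noteq> 0" "\<bar>i\<bar> \<le> int N \<Longrightarrow> 1 - \<delta> * q powi i \<noteq> 0"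
  using assms by (auto simp: regular_def)

lemma powi_nat_diff:
  fixes q :: complex
  assumes "q \<noteq> 0" and "i = int a - int b"
  shows "q powi i = q ^ a / q ^ b"
  by (simp only: assms(2) power_int_diff[OF disjI1[OF assms(1)]] power_int_of_nat)

subsection \<open>Raising and lowering operators\<close>

lemma raising_0: "raising \<delta> q k f 0 = raise_u \<delta> q k 0 * f 0"
  by (simp add: raising_def raise_u_def val_def)

lemma raise_u_top: "q \<noteq> 0 \<Longrightarrow> raise_u \<delta> q k (Suc k) = 0"
  by (simp add: raise_u_def)

lemma raise_v_0: "raise_v \<delta> q k 0 = 0"
  by (simp add: raise_v_def)

text \<open>At \<open>x = k\<close> the value \<open>f (Suc k)\<close> lies outside the domain and
  \<open>val\<close> replaces it by 0; the formula may still mention it because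
  \<open>raise_u\<close> vanishes at \<open>Suc k\<close>.\<close>

lemma raising_Suc:
  assumes "q \<noteq> 0" and "x \<le> k"
  shows "raising \<delta> q k f (Suc x) = raise_u \<delta> q k (Suc x) * f (Suc x) + raise_v \<delta> q k (Suc x) * f x"
proof (cases "x = k")
  case True
  then show ?thesis
    using assms by (simp add: raising_def raise_u_def raise_v_def val_def)
next
  case False
  then have "Suc x \<le> k" using assms by simp
  then have "val k f (int (Suc x)) = f (Suc x)" "val k f (int (Suc x) - 1) = f x"
    by (simp_all add: val_def nat_add_distrib)
  then show ?thesis
    unfolding raising_def raise_u_def raise_v_def by simp
qed

lemma raising_cong:
  assumes "\<And>x. x \<le> k \<Longrightarrow> f x = g x"
  shows "raising \<delta> q k f x = raising \<delta> q k g x"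
proof -
  have "val k f i = val k g i" for i using assms by (auto simp: val_def)
  then show ?thesis by (simp add: raising_def)
qed

lemma raising_scale: "raising \<delta> q k (\<lambda>x. c * f x) x = c * raising \<delta> q k f x"
  by (simp add: raising_def val_def algebra_simps)

text \<open>This is the value of R_k on the constant function 1. With X = q^x and K = q^(k+1), the
  terms linear in X cancel in the numerator, which is then divisible by 1 - \<delta> X^2 /
  K.\<close>

lemma raise_u_plus_v:
  assumes "regular \<delta> q (Suc k)" and "x \<le> Suc k"
  shows "raise_u \<delta> q k x + raise_v \<delta> q k x = q powi (- int k - 1) * (1 - q ^ Suc k)"
proof -
  note r = regularD[OF assms(1)]
  define X where "X = q ^ x"
  define K where "K = q ^ Suc k"
  have nz: "X \<noteq> 0" "K \<noteq> 0" using r by (auto simp: X_def K_def)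
  have e1: "q powi (int x - int k - 1) = X / K"
    unfolding X_def K_def by (rule powi_nat_diff) (use r in auto)
  have e2: "q powi (2 * int x - int k - 1) = X\<^sup>2 / K"
    unfolding X_def K_def power_mult[symmetric] by (rule powi_nat_diff) (use r in auto)
  have e3: "q powi (- int k - 1) = 1 / K"
    using powi_nat_diff[of q "- int k - 1" 0 "Suc k"] r by (simp add: K_def)
  have "1 - \<delta> * q powi (2 * int x - int k - 1) \<noteq> 0"
    by (rule r) (use assms(2) in auto)
  then have d: "1 - \<delta> * (X\<^sup>2 / K) \<noteq> 0" by (simp add: e2)
  have "raise_u \<delta> q k x + raise_v \<delta> q k x
      = (- ((1 - X / K) * (1 - \<delta> * (X / K))) + 1 / K * (1 - X) * (1 - \<delta> * X)) / (1 - \<delta> * (X\<^sup>2 / K))"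
    unfolding raise_u_def raise_v_def e1 e2 e3 by (simp add: X_def diff_divide_distrib)
  also have "- ((1 - X / K) * (1 - \<delta> * (X / K))) + 1 / K * (1 - X) * (1 - \<delta> * X)
      = 1 / K * (1 - K) * (1 - \<delta> * (X\<^sup>2 / K))"
    using nz by (simp add: field_simps power2_eq_square)
  also have "\<dots> / (1 - \<delta> * (X\<^sup>2 / K)) = 1 / K * (1 - K)"
    using d by simp
  finally show ?thesis by (simp only: e3 K_def)
qed

text \<open>The counterpart for L, its value on the constant 1. As \<open>racah_op\<close> kills
  constants, this value times that of R_k has to be minus the eigenvalue at
  \<open>Suc k\<close>.\<close>

lemma lower_a_plus_c:
  assumes "regular \<delta> q k" and "x \<le> k"
  shows "lower_a \<alpha> \<beta> \<delta> q k x + lower_c \<alpha> \<beta> \<delta> q k x = - (1 - \<alpha> * \<beta> * q ^ (k + 2))"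
proof -
  note r = regularD[OF assms(1)]
  define X where "X = q ^ (x + 1)"
  define K where "K = q ^ (k + 2)"
  have nz: "X \<noteq> 0" "K \<noteq> 0" using r by (auto simp: X_def K_def)
  have e1: "q powi (int x - int k - 1) = X / K"
    unfolding X_def K_def by (rule powi_nat_diff) (use r in auto)
  have e2: "q powi (2 * int x - int k) = X\<^sup>2 / K"
    unfolding X_def K_def power_mult[symmetric] by (rule powi_nat_diff) (use r in auto)
  have "1 - \<delta> * q powi (2 * int x - int k) \<noteq> 0"
    by (rule r) (use assms(2) in auto)
  then have d: "1 - \<delta> * (X\<^sup>2 / K) \<noteq> 0" by (simp add: e2)
  have "lower_a \<alpha> \<beta> \<delta> q k x + lower_c \<alpha> \<beta> \<delta> q k x
      = (- ((1 - \<alpha> * X) * (1 - \<beta> * \<delta> * X)) + (\<alpha> - \<delta> * (X / K)) * (\<beta> * K - X)) / (1 - \<delta> * (X\<^sup>2 / K))"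
    unfolding lower_a_def lower_c_def e1 e2 X_def[symmetric] K_def[symmetric]
    by (simp add: diff_divide_distrib)
  also have "- ((1 - \<alpha> * X) * (1 - \<beta> * \<delta> * X)) + (\<alpha> - \<delta> * (X / K)) * (\<beta> * K - X)
      = - (1 - \<alpha> * \<beta> * K) * (1 - \<delta> * (X\<^sup>2 / K))"
    using nz by (simp add: field_simps power2_eq_square)
  also have "\<dots> / (1 - \<delta> * (X\<^sup>2 / K)) = - (1 - \<alpha> * \<beta> * K)"
    using d by simp
  finally show ?thesis by (simp only: K_def)
qed

text \<open>B vanishes at \<open>x = N\<close> through 1 - q^(x-N), and D at \<open>x = 0\<close>
  through 1 - q^x. Hence \<open>f (Suc N)\<close> and the truncated \<open>x - 1\<close> are
  harmless, and so are the denominators with exponents N + 1 and - N - 1, which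
  \<open>regular\<close> does not control.\<close>

lemma racah_op_eq:
  assumes "q \<noteq> 0" and "x \<le> N"
  shows "racah_op \<alpha> \<beta> \<delta> N q f x = racah_B \<alpha> \<beta> \<delta> N q x * (f (Suc x) - f x)
    + racah_D \<alpha> \<beta> \<delta> N q x * (f (x - 1) - f x)"
proof -
  have "racah_B \<alpha> \<beta> \<delta> N q x * val N f (int x + 1) = racah_B \<alpha> \<beta> \<delta> N q x * f (Suc x)"
    using assms by (cases "x = N") (auto simp: val_def racah_B_def nat_add_distrib)
  moreover have "racah_D \<alpha> \<beta> \<delta> N q x * val N f (int x - 1) = racah_D \<alpha> \<beta> \<delta> N q x * f (x - 1)"
    using assms by (cases "x = 0") (auto simp: val_def racah_D_def nat_diff_distrib)
  moreover have "val N f (int x) = f x" using assms by (simp add: val_def)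
  ultimately show ?thesis
    unfolding racah_op_def by (simp only: left_diff_distrib right_diff_distrib distrib_right) simp
qed

lemma raise_u_lower_a: "raise_u \<delta> q k x * lower_a \<alpha> \<beta> \<delta> q k x = racah_B \<alpha> \<beta> \<delta> (Suc k) q x"
proof -
  have e: "2 * int x - int (Suc k) + 1 = 2 * int x - int k"
    "int x - int (Suc k) = int x - int k - 1" "2 * int x - int (Suc k) = 2 * int x - int k - 1"
    by auto
  show ?thesis
    unfolding raise_u_def lower_a_def racah_B_def e by (simp add: mult_ac)
qed

lemma raise_v_lower_c:
  assumes "q \<noteq> 0"
  shows "raise_v \<delta> q k (Suc x) * lower_c \<alpha> \<beta> \<delta> q k x = racah_D \<alpha> \<beta> \<delta> (Suc k) q (Suc x)"
proof -
  have e: "2 * int (Suc x) - int (Suc k) - 1 = 2 * int x - int k"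
    "2 * int (Suc x) - int (Suc k) = 2 * int (Suc x) - int k - 1"
    "int (Suc x) - int (Suc k) - 1 = int x - int k - 1" by auto
  have "q powi (- int (Suc k) - 1) = q powi (- int k - 1) / q"
    using power_int_diff[OF disjI1[OF assms], of "- int k - 1" 1] by (simp add: algebra_simps)
  moreover have "\<beta> * q ^ (Suc k + 2) - q ^ (Suc x + 1) = (\<beta> * q ^ (k + 2) - q ^ (x + 1)) * q"
    by (simp add: algebra_simps)
  ultimately show ?thesis
    unfolding raise_v_def lower_c_def racah_D_def e using assms by simp
qed

lemma lower_a_raise_u: "lower_a \<alpha> \<beta> \<delta> q k x * raise_u \<delta> q k (Suc x) = racah_B \<alpha> \<beta> \<delta> k q x"
proof -
  have e: "int (Suc x) - int k - 1 = int x - int k"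
    "2 * int (Suc x) - int k - 1 = 2 * int x - int k + 1" by auto
  show ?thesis
    unfolding raise_u_def lower_a_def racah_B_def e by (simp add: mult_ac)
qed

lemma lower_c_raise_v: "lower_c \<alpha> \<beta> \<delta> q k x * raise_v \<delta> q k x = racah_D \<alpha> \<beta> \<delta> k q x"
  unfolding raise_v_def lower_c_def racah_D_def by simp

lemma racah_eigenvalue_Suc:
  "racah_eigenvalue \<alpha> \<beta> q (Suc k) = q powi (- int k - 1) * (1 - q ^ Suc k) * (1 - \<alpha> * \<beta> * q ^ (k + 2))"
proof -
  have e: "- int (Suc k) = - int k - 1" by simp
  show ?thesis unfolding racah_eigenvalue_def e by simp
qed

text \<open>The neighbours f(x + 1) and f(x - 1) receive B and D by \<open>raise_u_lower_a\<close>
  and \<open>raise_v_lower_c\<close>. The diagonal coefficient u(x) c(x) + v(x) a(x - 1) is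
  rewritten with a + c = - h and u + v = g; it differs from - B - D by - g h, minus the
  eigenvalue.\<close>

lemma racah_op_factor:
  assumes "regular \<delta> q (Suc k)" and "x \<le> Suc k"
  shows "racah_op \<alpha> \<beta> \<delta> (Suc k) q f x
    = raising \<delta> q k (lowering \<alpha> \<beta> \<delta> q k f) x + racah_eigenvalue \<alpha> \<beta> q (Suc k) * f x"
proof -
  note r = regularD[OF assms(1)]
  note rk = regular_antimono[OF assms(1), of k, simplified]
  define u where "u = raise_u \<delta> q k"
  define v where "v = raise_v \<delta> q k"
  define a where "a = lower_a \<alpha> \<beta> \<delta> q k"
  define c where "c = lower_c \<alpha> \<beta> \<delta> q k"
  define g where "g = q powi (- int k - 1) * (1 - q ^ Suc k)"
  define h where "h = 1 - \<alpha> * \<beta> * q ^ (k + 2)"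
  have ev: "racah_eigenvalue \<alpha> \<beta> q (Suc k) = g * h"
    by (simp only: racah_eigenvalue_Suc g_def h_def)
  have uv: "u x + v x = g"
    unfolding u_def v_def g_def by (rule raise_u_plus_v[OF assms])
  \<comment> \<open>\<open>lower_a_plus_c\<close> stops at \<open>k\<close>; at the top point
    \<open>x = Suc k\<close> the factor u vanishes instead.\<close>
  have uc: "u x * c x = - u x * h - u x * a x"
  proof (cases "x \<le> k")
    case True
    have "a x + c x = - h" unfolding a_def c_def h_def by (rule lower_a_plus_c[OF rk True])
    then have cx: "c x = - h - a x" by (simp add: algebra_simps)
    show ?thesis unfolding cx by (simp add: algebra_simps)
  next
    case False
    then have "x = Suc k" using assms by simp
    then show ?thesis using r by (simp add: u_def raise_u_top)
  qed
  have B: "racah_B \<alpha> \<beta> \<delta> (Suc k) q x = u x * a x"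
    by (simp add: u_def a_def raise_u_lower_a)
  note op = racah_op_eq[OF r(1) assms(2)]
  show ?thesis
  proof (cases x)
    case 0
    have "v x = 0" by (simp add: v_def 0 raise_v_0)
    with uv have g: "g = u x" by simp
    have "racah_D \<alpha> \<beta> \<delta> (Suc k) q x = 0" by (simp add: 0 racah_D_def)
    then have "racah_op \<alpha> \<beta> \<delta> (Suc k) q f x = u x * a x * (f (Suc x) - f x)"
      by (simp add: op B)
    also have "\<dots> = u x * a x * f (Suc x) + (u x * c x) * f x + u x * h * f x"
      unfolding uc by (simp add: algebra_simps)
    also have "\<dots> = raising \<delta> q k (lowering \<alpha> \<beta> \<delta> q k f) x + g * h * f x"
      by (simp add: 0 raising_0 lowering_def u_def a_def c_def g[unfolded 0 u_def] algebra_simps)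
    finally show ?thesis by (simp only: ev)
  next
    case (Suc y)
    have y: "y \<le> k" using assms Suc by simp
    have D: "racah_D \<alpha> \<beta> \<delta> (Suc k) q x = v x * c y"
      by (simp add: v_def c_def Suc raise_v_lower_c r)
    have "a y + c y = - h" unfolding a_def c_def h_def by (rule lower_a_plus_c[OF rk y])
    then have cy: "a y = - h - c y" by (simp add: algebra_simps)
    have "raising \<delta> q k (lowering \<alpha> \<beta> \<delta> q k f) x
        = u x * (a x * f (Suc x) + c x * f x) + v x * (a y * f x + c y * f y)"
      by (simp add: Suc raising_Suc[OF r(1) y] lowering_def u_def v_def a_def c_def)
    also have "\<dots> = u x * a x * f (Suc x) + (u x * c x) * f x + v x * (a y * f x + c y * f y)"
      by (simp add: algebra_simps)
    also have "\<dots> = u x * a x * (f (Suc x) - f x) + v x * c y * (f y - f x) - (u x + v x) * h * f x"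
      unfolding uc cy by (simp add: algebra_simps)
    finally show ?thesis unfolding op B D ev uv by (simp add: Suc)
  qed
qed

text \<open>In this order the diagonal coefficient is a(x) v(x + 1) + c(x) u(x) = g (a(x) + c(x)) -
  B(x) - D(x), by u + v = g at both x and x + 1.\<close>

lemma lowering_raising:
  assumes "regular \<delta> q (Suc k)" and "x \<le> k"
  shows "lowering \<alpha> \<beta> \<delta> q k (raising \<delta> q k f) x
    = racah_op \<alpha> \<beta> \<delta> k q f x - racah_eigenvalue \<alpha> \<beta> q (Suc k) * f x"
proof -
  note r = regularD[OF assms(1)]
  note rk = regular_antimono[OF assms(1), of k, simplified]
  define u where "u = raise_u \<delta> q k"
  define v where "v = raise_v \<delta> q k"
  define a where "a = lower_a \<alpha> \<beta> \<delta> q k"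
  define c where "c = lower_c \<alpha> \<beta> \<delta> q k"
  define g where "g = q powi (- int k - 1) * (1 - q ^ Suc k)"
  define h where "h = 1 - \<alpha> * \<beta> * q ^ (k + 2)"
  have ev: "racah_eigenvalue \<alpha> \<beta> q (Suc k) = g * h"
    by (simp only: racah_eigenvalue_Suc g_def h_def)
  have "u (Suc x) + v (Suc x) = g" "u x + v x = g"
    unfolding u_def v_def g_def by (rule raise_u_plus_v[OF assms(1)]; use assms in simp)+
  then have uv: "v (Suc x) = g - u (Suc x)" "u x = g - v x" by (auto simp: algebra_simps)
  have "a x + c x = - h" unfolding a_def c_def h_def by (rule lower_a_plus_c[OF rk assms(2)])
  then have ac: "g * a x * f x + g * c x * f x = - g * h * f x"
    by (metis (no_types) distrib_left distrib_right mult_minus_left mult_minus_right)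
  have B: "racah_B \<alpha> \<beta> \<delta> k q x = a x * u (Suc x)"
    by (simp add: u_def a_def lower_a_raise_u)
  have D: "racah_D \<alpha> \<beta> \<delta> k q x = c x * v x"
    by (simp add: v_def c_def lower_c_raise_v)
  have r1: "raising \<delta> q k f (Suc x) = u (Suc x) * f (Suc x) + v (Suc x) * f x"
    unfolding u_def v_def by (rule raising_Suc[OF r(1) assms(2)])
  have r2: "raising \<delta> q k f x = u x * f x + v x * f (x - 1)"
    using assms(2) by (cases x) (auto simp: raising_0 raise_v_0 raising_Suc r u_def v_def)
  have "lowering \<alpha> \<beta> \<delta> q k (raising \<delta> q k f) x
      = a x * (u (Suc x) * f (Suc x) + v (Suc x) * f x) + c x * (u x * f x + v x * f (x - 1))"
    by (simp add: lowering_def a_def c_def r1 r2)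
  also have "\<dots> = a x * u (Suc x) * (f (Suc x) - f x) + c x * v x * (f (x - 1) - f x)
      + (g * a x * f x + g * c x * f x)"
    unfolding uv by (simp add: algebra_simps)
  finally show ?thesis
    unfolding ac racah_op_eq[OF r(1) assms(2)] B D ev by simp
qed


subsection \<open>The functions \<open>r\<^sub>n\<close> and the difference equation\<close>

lemma r_fun_self: "qpoch q q n \<noteq> 0 \<Longrightarrow> r_fun n \<alpha> \<beta> \<delta> n q = r_diag n \<alpha> \<beta> \<delta> q"
  by (simp add: r_fun_def fun_eq_iff)

text \<open>The normalising factor of one step is the reciprocal of the constant R_N 1, so for
  regular parameters r_0 is the constant 1 at every level.\<close>

lemma r_fun_Suc:
  assumes "n \<le> N"
  shows "r_fun n \<alpha> \<beta> \<delta> (Suc N) q x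
    = q ^ Suc N / (1 - q ^ Suc N) * raising \<delta> q N (r_fun n \<alpha> \<beta> \<delta> N q) x"
proof -
  obtain d where d: "N = n + d" using assms le_Suc_ex by auto
  have "Suc N - n = Suc d" "N - n = d" by (simp_all add: d)
  \<comment> \<open>(N - n)(N + n + 1)/2 is the sum of n + 1, ..., N, so one more level adds
    \<open>Suc N\<close> to the exponent.\<close>
  then have "(Suc N - n) * (Suc N + n + 1) = (N - n) * (N + n + 1) + 2 * Suc N"
    by (simp add: d algebra_simps)
  then have e: "(Suc N - n) * (Suc N + n + 1) div 2 = (N - n) * (N + n + 1) div 2 + Suc N"
    by (simp only:) simp
  have "r_fun n \<alpha> \<beta> \<delta> N q = (\<lambda>x. qpoch q q n / qpoch q q N * q ^ ((N - n) * (N + n + 1) div 2)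
      * fold (raising \<delta> q) [n..<N] (r_diag n \<alpha> \<beta> \<delta> q) x)"
    by (simp add: fun_eq_iff r_fun_def)
  then show ?thesis
    by (simp only: raising_scale r_fun_def e qpoch_Suc[of q q N] power_add[of q _ "Suc N"])
       (use assms in \<open>simp add: mult_ac\<close>)
qed

lemma qpoch_self_nonzero: "(\<And>j. q ^ Suc j \<noteq> 1) \<Longrightarrow> qpoch q q k \<noteq> 0"
  by (rule qpoch_nonzero) simp

definition admissible :: "complex \<Rightarrow> complex \<Rightarrow> complex \<Rightarrow> complex \<Rightarrow> nat \<Rightarrow> bool" where
  "admissible \<alpha> \<beta> \<delta> q N \<longleftrightarrow> \<alpha> \<noteq> 0 \<and> \<beta> \<noteq> 0
     \<and> (\<forall>j\<in>{1..N}. \<alpha> * q ^ j \<noteq> 1) \<and> (\<forall>j\<in>{1..N}. \<beta> * \<delta> * q ^ j \<noteq> 1)"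

lemma admissible_antimono: "admissible \<alpha> \<beta> \<delta> q N \<Longrightarrow> M \<le> N \<Longrightarrow> admissible \<alpha> \<beta> \<delta> q M"
  unfolding admissible_def by auto

lemma admissible_qpoch:
  assumes "admissible \<alpha> \<beta> \<delta> q N" and "k \<le> N"
  shows "qpoch (\<alpha> * q) q k \<noteq> 0" "qpoch (\<beta> * \<delta> * q) q k \<noteq> 0"
proof -
  have "\<alpha> * q ^ Suc i \<noteq> 1 \<and> \<beta> * \<delta> * q ^ Suc i \<noteq> 1" if "i < k" for i
  proof -
    have "Suc i \<in> {1..N}" using that assms by simp
    then show ?thesis using assms(1) unfolding admissible_def by blast
  qed
  then show "qpoch (\<alpha> * q) q k \<noteq> 0" "qpoch (\<beta> * \<delta> * q) q k \<noteq> 0"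
    by (auto intro!: qpoch_nonzero simp: mult_ac)
qed

text \<open>L f = 0 is the first-order recurrence f(x + 1) = - c(x) / a(x) f(x), and
  \<open>r_diag\<close> is its solution with value 1 at 0: the base \<alpha> \<beta> q^(n+1) of its
  power and the new factors of its four q-shifted factorials make up exactly this quotient.\<close>

lemma lowering_r_diag:
  assumes "q \<noteq> 0" and "admissible \<alpha> \<beta> \<delta> q (Suc k)" and "x \<le> k"
  shows "lowering \<alpha> \<beta> \<delta> q k (r_diag (Suc k) \<alpha> \<beta> \<delta> q) x = 0"
proof -
  define X where "X = q ^ x"
  define K where "K = q ^ Suc k"
  define d where "d = 1 - \<delta> * q powi (2 * int x - int k)"
  have nz: "X \<noteq> 0" "K \<noteq> 0" "\<alpha> \<noteq> 0" "\<beta> \<noteq> 0"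
    using assms by (auto simp: X_def K_def admissible_def)
  have "Suc x \<in> {1..Suc k}" using assms by simp
  then have "\<alpha> * q ^ Suc x \<noteq> 1" "\<beta> * \<delta> * q ^ Suc x \<noteq> 1"
    using assms(2) unfolding admissible_def by blast+
  then have fnz: "1 - \<alpha> * q * X \<noteq> 0" "1 - \<beta> * \<delta> * q * X \<noteq> 0"
    by (auto simp: X_def mult_ac)
  have e1: "q powi (int x - int k - 1) = X / K"
    unfolding X_def K_def by (rule powi_nat_diff) (use assms in auto)
  have e2: "q powi (- int (Suc k)) = 1 / K"
    using powi_nat_diff[of q "- int (Suc k)" 0 "Suc k"] assms by (simp add: K_def)
  define A where "A = 1 - inverse \<alpha> * \<delta> * (1 / K) * X"
  define B where "B = 1 - inverse \<beta> * (1 / K) * X"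
  define r where "r = r_diag (Suc k) \<alpha> \<beta> \<delta> q x"
  have e3: "q ^ (Suc k + 1) = K * q" "q ^ (k + 2) = K * q" "q ^ (x + 1) = X * q"
    by (simp_all add: K_def X_def)
  have s: "r_diag (Suc k) \<alpha> \<beta> \<delta> q (Suc x)
      = r * (\<alpha> * \<beta> * (K * q) * A * B / ((1 - \<alpha> * q * X) * (1 - \<beta> * \<delta> * q * X)))"
    unfolding r_def r_diag_def qpoch_Suc e2 e3 A_def B_def X_def[symmetric] power_Suc
    by (simp add: mult_ac)
  have "lowering \<alpha> \<beta> \<delta> q k (r_diag (Suc k) \<alpha> \<beta> \<delta> q) x
     = r / d * ((\<alpha> - \<delta> * (X / K)) * (\<beta> * (K * q) - X * q) - \<alpha> * \<beta> * (K * q) * A * B)"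
    unfolding lowering_def lower_a_def lower_c_def s e1 e3 d_def[symmetric] r_def[symmetric]
    using fnz by (simp add: divide_simps) (simp add: algebra_simps)
  also have "(\<alpha> - \<delta> * (X / K)) * (\<beta> * (K * q) - X * q) = \<alpha> * \<beta> * (K * q) * A * B"
    unfolding A_def B_def using nz by (simp add: field_simps)
  finally show ?thesis by simp
qed

lemma racah_op_r_diag:
  assumes "regular \<delta> q n" and "admissible \<alpha> \<beta> \<delta> q n" and "x \<le> n"
  shows "racah_op \<alpha> \<beta> \<delta> n q (r_diag n \<alpha> \<beta> \<delta> q) x = racah_eigenvalue \<alpha> \<beta> q n * r_diag n \<alpha> \<beta> \<delta> q x"
proof (cases n)
  case 0
  then show ?thesis
    using assms by (simp add: racah_op_eq regularD racah_B_def racah_D_def racah_eigenvalue_def)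
next
  case (Suc k)
  note r = regularD[OF assms(1)]
  have "raising \<delta> q k (lowering \<alpha> \<beta> \<delta> q k (r_diag n \<alpha> \<beta> \<delta> q)) x = raising \<delta> q k (\<lambda>_. 0) x"
    by (rule raising_cong) (use assms r in \<open>simp add: Suc lowering_r_diag\<close>)
  also have "\<dots> = 0" by (simp add: raising_def val_def)
  finally show ?thesis using racah_op_factor[of \<delta> q k x] assms by (simp add: Suc)
qed

lemma racah_op_r_fun:
  assumes "n \<le> N" and "regular \<delta> q N" and "admissible \<alpha> \<beta> \<delta> q n" and "x \<le> N"
  shows "racah_op \<alpha> \<beta> \<delta> N q (r_fun n \<alpha> \<beta> \<delta> N q) x
    = racah_eigenvalue \<alpha> \<beta> q n * r_fun n \<alpha> \<beta> \<delta> N q x"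
  using assms
proof (induction N arbitrary: x rule: dec_induct)
  case base
  then have "qpoch q q n \<noteq> 0" by (intro qpoch_self_nonzero regularD(2))
  then show ?case using base by (simp add: r_fun_self racah_op_r_diag)
next
  case (step N)
  define g where "g = r_fun n \<alpha> \<beta> \<delta> N q"
  define c where "c = q ^ Suc N / (1 - q ^ Suc N)"
  define l where "l = racah_eigenvalue \<alpha> \<beta> q n"
  define m where "m = racah_eigenvalue \<alpha> \<beta> q (Suc N)"
  have rs: "r_fun n \<alpha> \<beta> \<delta> (Suc N) q = (\<lambda>x. c * raising \<delta> q N g x)"
    unfolding c_def g_def by (rule ext) (rule r_fun_Suc[OF step.hyps(1)])
  have IH: "racah_op \<alpha> \<beta> \<delta> N q g y = l * g y" if "y \<le> N" for y
    unfolding g_def l_def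
    using step.IH step.prems(2) regular_antimono[OF step.prems(1)] that by simp
  have "raising \<delta> q N (lowering \<alpha> \<beta> \<delta> q N (\<lambda>x. c * raising \<delta> q N g x)) x
      = raising \<delta> q N (\<lambda>y. (c * (l - m)) * g y) x"
  proof (rule raising_cong)
    fix y assume y: "y \<le> N"
    have "lowering \<alpha> \<beta> \<delta> q N (\<lambda>x. c * raising \<delta> q N g x) y
        = c * lowering \<alpha> \<beta> \<delta> q N (raising \<delta> q N g) y"
      by (simp add: lowering_def algebra_simps)
    also have "\<dots> = c * (l - m) * g y"
      by (simp add: lowering_raising[OF step.prems(1) y] IH[OF y] m_def algebra_simps)
    finally show "lowering \<alpha> \<beta> \<delta> q N (\<lambda>x. c * raising \<delta> q N g x) y = c * (l - m) * g y" .
  qed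
  also have "\<dots> = c * (l - m) * raising \<delta> q N g x" by (rule raising_scale)
  finally show ?case
    unfolding rs racah_op_factor[OF step.prems(1,3)] l_def[symmetric] m_def[symmetric]
    by (simp add: algebra_simps)
qed

subsection \<open>Orthogonality\<close>

text \<open>\<open>inner_V\<close> without the conjugation. This form is symmetric, and L can be
  moved across it without conjugating its coefficients.\<close>

definition bilinear_V :: "complex \<Rightarrow> complex \<Rightarrow> complex \<Rightarrow> nat \<Rightarrow> complex
    \<Rightarrow> (nat \<Rightarrow> complex) \<Rightarrow> (nat \<Rightarrow> complex) \<Rightarrow> complex" where
  "bilinear_V \<alpha> \<beta> \<delta> N q f g = (\<Sum>x\<le>N. weight \<alpha> \<beta> \<delta> N q x * f x * g x)"

definition weight_base :: "complex \<Rightarrow> nat \<Rightarrow> complex \<Rightarrow> nat \<Rightarrow> complex" where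
  "weight_base \<delta> N q x = (\<Prod>i<x. - inverse \<delta> / q ^ Suc i) * q ^ (N * (N + 1) div 2 + x)
     * (1 - inverse \<delta> * q powi (int N - 2 * int x))
     / (qpoch q q x * qpoch q q (N - x) * qpoch (inverse \<delta> * q powi (- int x)) q (N + 1))"

lemma powi_minus_Suc:
  assumes "(q::complex) \<noteq> 0"
  shows "q powi (- int (Suc x)) = q powi (- int x) / q"
proof -
  have e: "- int (Suc x) = - int x - 1" by simp
  show ?thesis unfolding e using assms by (simp add: power_int_diff)
qed

lemma qpoch_inverse_shift:
  assumes "q \<noteq> 0"
  shows "qpoch (c * q powi (- int (Suc x))) q (Suc k)
    = (1 - c / q ^ Suc x) * qpoch (c * q powi (- int x)) q k"
proof -
  have "q powi (- int (Suc x)) = 1 / q ^ Suc x"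
    unfolding power_int_minus power_int_of_nat by (simp add: field_simps)
  moreover have "c * q powi (- int (Suc x)) * q = c * q powi (- int x)"
    using assms by (simp add: powi_minus_Suc del: of_nat_Suc)
  ultimately show ?thesis by (simp add: qpoch_Suc_shift)
qed

text \<open>
  \<open>weight_base\<close> collects the factors independent of \<open>\<alpha>\<close> and \<open>\<beta>\<close>; the power \<open>\<beta>\<^sup>x\<close> turns
  \<open>(\<beta>\<^sup>-\<^sup>1\<delta>\<^sup>-\<^sup>1q\<^sup>-\<^sup>x;q)\<^sub>x\<close> into a multiple of \<open>(\<beta>\<delta>q;q)\<^sub>x\<close>.
\<close>

lemma weight_eq:
  assumes "q \<noteq> 0" "\<beta> \<noteq> 0" "\<delta> \<noteq> 0"
  shows "weight \<alpha> \<beta> \<delta> N q x = qpoch (\<alpha> * q) q x * qpoch (\<beta> * \<delta> * q) q x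
    * qpoch (\<beta> * q) q (N - x) * qpoch (\<alpha> * inverse \<delta> * q) q (N - x) * weight_base \<delta> N q x"
proof -
  have "qpoch (inverse \<beta> * inverse \<delta> * q powi (- int x)) q x * \<beta> ^ x
      = (\<Prod>i<x. - inverse \<delta> / q ^ Suc i) * qpoch (\<beta> * \<delta> * q) q x"
  proof (induction x)
    case (Suc x)
    have "\<beta> * (1 - inverse \<beta> * inverse \<delta> / q ^ Suc x)
        = (- inverse \<delta> / q ^ Suc x) * (1 - \<beta> * \<delta> * q * q ^ x)"
      using assms by (simp add: field_simps)
    then have "\<beta> * (1 - inverse \<beta> * inverse \<delta> / q ^ Suc x)
          * (qpoch (inverse \<beta> * inverse \<delta> * q powi (- int x)) q x * \<beta> ^ x)
        = (- inverse \<delta> / q ^ Suc x) * (1 - \<beta> * \<delta> * q * q ^ x)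
          * ((\<Prod>i<x. - inverse \<delta> / q ^ Suc i) * qpoch (\<beta> * \<delta> * q) q x)"
      using Suc by (simp only:)
    then show ?case
      unfolding qpoch_inverse_shift[OF assms(1)] qpoch_Suc[of "\<beta> * \<delta> * q"] prod.lessThan_Suc power_Suc[of \<beta>]
      by (simp only: mult_ac)
  qed simp
  then show ?thesis
    unfolding weight_def weight_base_def times_divide_eq_right times_divide_eq_left
    by (simp add: mult_ac)
qed

section \<open>Weights of consecutive levels and the adjoint relation\<close>

lemma regular_inverse:
  assumes "regular \<delta> q N" and "\<bar>i\<bar> \<le> int N"
  shows "1 - inverse \<delta> * q powi i \<noteq> 0"
proof -
  have "1 - \<delta> * q powi (- i) \<noteq> 0" by (rule regularD(4)[OF assms(1)]) (use assms in simp)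
  then show ?thesis using regularD[OF assms(1)] by (auto simp: power_int_minus field_simps)
qed

lemma weight_base_Suc:
  assumes "regular \<delta> q (Suc N)" and "x \<le> N"
  shows "weight_base \<delta> (Suc N) q x = weight_base \<delta> N q x
    * (q ^ Suc N * (1 - inverse \<delta> * q powi (int N + 1 - 2 * int x))
       / ((1 - inverse \<delta> * q powi (int N - 2 * int x)) * (1 - q ^ Suc (N - x))
          * (1 - inverse \<delta> * q ^ Suc (N - x))))"
proof -
  note r = regularD[OF assms(1)]
  have d: "1 - inverse \<delta> * q powi (int N - 2 * int x) \<noteq> 0"
    by (rule regular_inverse[OF assms(1)]) (use assms in simp)
  have e1: "Suc N * (Suc N + 1) div 2 + x = (N * (N + 1) div 2 + x) + Suc N" by simp
  have e2: "int (Suc N) - 2 * int x = int N + 1 - 2 * int x" by simp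
  have e3: "Suc N - x = Suc (N - x)" using assms by simp
  have e4: "inverse \<delta> * q powi (- int x) * q ^ (N + 1) = inverse \<delta> * q ^ Suc (N - x)"
  proof -
    have "q powi (- int x) * q ^ (N + 1) = q ^ Suc (N - x)"
      using r assms by (simp add: power_int_minus power_diff field_simps)
    then show ?thesis by (simp only: mult.assoc)
  qed
  have e5: "qpoch (inverse \<delta> * q powi (- int x)) q (Suc N + 1)
      = qpoch (inverse \<delta> * q powi (- int x)) q (N + 1) * (1 - inverse \<delta> * q ^ Suc (N - x))"
    unfolding add_Suc qpoch_Suc[of _ _ "N + 1"] e4 ..
  have e6: "qpoch q q (Suc (N - x)) = qpoch q q (N - x) * (1 - q ^ Suc (N - x))"
    by (simp add: qpoch_Suc)
  have cancel: "p * (Q * K) * u / (a * (b * e) * (c * f)) = p * Q * w / (a * b * c) * (K * u / (w * e * f))"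
    if "w \<noteq> 0" for p Q K u a b c e f w :: complex
    using that by (simp add: mult_ac)
  show ?thesis
    unfolding weight_base_def e1 e2 e3 e5 e6 power_add[of q _ "Suc N"]
    by (rule cancel) (rule d)
qed

lemma weight_base_Suc_Suc:
  assumes "regular \<delta> q (Suc N)" and "x \<le> N"
  shows "weight_base \<delta> (Suc N) q (Suc x) = weight_base \<delta> N q x
    * (q ^ Suc N * q * (1 - inverse \<delta> * q powi (int N - 1 - 2 * int x)) * (- inverse \<delta> / q ^ Suc x)
       / ((1 - inverse \<delta> * q powi (int N - 2 * int x)) * (1 - q ^ Suc x)
          * (1 - inverse \<delta> / q ^ Suc x)))"
proof -
  note r = regularD[OF assms(1)]
  have d: "1 - inverse \<delta> * q powi (int N - 2 * int x) \<noteq> 0"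
    by (rule regular_inverse[OF assms(1)]) (use assms in simp)
  have e1: "Suc N * (Suc N + 1) div 2 + Suc x = (N * (N + 1) div 2 + x) + Suc N + 1" by simp
  have e2: "int (Suc N) - 2 * int (Suc x) = int N - 1 - 2 * int x" by simp
  have e3: "Suc N - Suc x = N - x" by simp
  have e5: "qpoch (inverse \<delta> * q powi (- int (Suc x))) q (Suc N + 1)
      = (1 - inverse \<delta> / q ^ Suc x) * qpoch (inverse \<delta> * q powi (- int x)) q (N + 1)"
    unfolding add_Suc using qpoch_inverse_shift[OF r(1)] .
  have e6: "qpoch q q (Suc x) = qpoch q q x * (1 - q ^ Suc x)"
    by (simp add: qpoch_Suc)
  have e7: "q ^ (N * (N + 1) div 2 + x + Suc N + 1) = q ^ (N * (N + 1) div 2 + x) * q ^ Suc N * q"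
    by (simp add: power_add)
  have cancel: "p * r * (Q * K * q) * u / (a * e * b * (f * c)) = p * Q * w / (a * b * c) * (K * q * u * r / (w * e * f))"
    if "w \<noteq> 0" for p r Q K u a b c e f w :: complex
    using that by (simp add: mult_ac)
  show ?thesis
    unfolding weight_base_def e1 e2 e3 e5 e6 e7 prod.lessThan_Suc
    by (rule cancel) (rule d)
qed

text \<open>Half of the adjoint relation: the coefficients of f(x) g(x). The factors of
  \<open>lower_c\<close> that contain \<alpha> and \<beta> are those by which (\<beta> q; q) and
  (\<alpha> q / \<delta>; q) grow when their length N - x becomes N + 1 - x; what remains is an
  identity between the \<open>weight_base\<close> terms.\<close>

lemma weight_raise_u:
  assumes "regular \<delta> q (Suc N)" and "x \<le> N" and "\<beta> \<noteq> 0"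
  shows "weight \<alpha> \<beta> \<delta> (Suc N) q x * raise_u \<delta> q N x
    = - (weight \<alpha> \<beta> \<delta> N q x * lower_c \<alpha> \<beta> \<delta> q N x)"
proof -
  note r = regularD[OF assms(1)]
  define X where "X = q ^ x"
  define Z where "Z = q ^ Suc (N - x)"
  have nz: "X \<noteq> 0" "Z \<noteq> 0" "q \<noteq> 0" "\<delta> \<noteq> 0" using r by (auto simp: X_def Z_def)
  have K: "q ^ Suc N = X * Z" using assms by (simp add: X_def Z_def flip: power_add)
  have K2: "q ^ (N + 2) = X * Z * q" using K by simp
  have K3: "q ^ (x + 1) = X * q" by (simp add: X_def)
  have p1: "q powi (int N + 1 - 2 * int x) = Z / X"
    unfolding X_def Z_def by (rule powi_nat_diff) (use r assms in auto)
  have p2: "q powi (int N - 2 * int x) = Z / (X * q)"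
    unfolding X_def Z_def power_Suc2[symmetric] by (rule powi_nat_diff) (use r assms in auto)
  have p3: "q powi (int x - int N - 1) = 1 / Z"
    unfolding Z_def using powi_nat_diff[of q "int x - int N - 1" 0 "Suc (N - x)"] r assms by simp
  have p4: "q powi (2 * int x - int N - 1) = X / Z"
    unfolding X_def Z_def by (rule powi_nat_diff) (use r assms in auto)
  have p5: "q powi (2 * int x - int N) = X * q / Z"
    unfolding X_def Z_def power_Suc2[symmetric] by (rule powi_nat_diff) (use r assms in auto)
  have d1: "1 - \<delta> * (X / Z) \<noteq> 0" using r(4)[of "2 * int x - int N - 1"] assms by (simp add: p4)
  have d2: "1 - \<delta> * (X * q / Z) \<noteq> 0" using r(4)[of "2 * int x - int N"] assms by (simp add: p5)
  have d3: "1 - Z \<noteq> 0" unfolding Z_def using r(2) by simp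
  have d4: "1 - inverse \<delta> * Z \<noteq> 0"
    unfolding Z_def using regular_inverse[OF assms(1), of "int (Suc (N - x))"] assms
    by (simp only: power_int_of_nat) auto
  have f1: "1 - inverse \<delta> * (Z / X) = - Z / (\<delta> * X) * (1 - \<delta> * (X / Z))"
    using nz by (simp add: field_simps)
  have f2: "1 - inverse \<delta> * (Z / (X * q)) = - Z / (\<delta> * X * q) * (1 - \<delta> * (X * q / Z))"
    using nz by (simp add: field_simps)
  have f3: "1 - 1 / Z = - (1 - Z) / Z" using nz by (simp add: field_simps)
  have f4: "1 - \<delta> * (1 / Z) = - \<delta> * (1 - inverse \<delta> * Z) / Z" using nz by (simp add: field_simps)
  have f5: "(\<alpha> - \<delta> * (1 / Z)) * (\<beta> * (X * Z * q) - X * q)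
      = \<delta> * (X * q / Z) * (1 - \<alpha> * inverse \<delta> * Z) * (1 - \<beta> * Z)"
    using nz by (simp add: field_simps)
  have cancel: "g * (X * Z * (- Z / (\<delta> * X) * u) / (- Z / (\<delta> * X * q) * w * a * b))
      * - (- a / Z * (- \<delta> * b / Z) / u) = - (g * (\<delta> * (X * q / Z) / w))"
    if "u \<noteq> 0" "w \<noteq> 0" "a \<noteq> 0" "b \<noteq> 0" for g u w a b
    using that nz by (simp add: field_simps)
  have base: "weight_base \<delta> (Suc N) q x * raise_u \<delta> q N x
      = - (weight_base \<delta> N q x * (\<delta> * (X * q / Z) / (1 - \<delta> * (X * q / Z))))"
    unfolding weight_base_Suc[OF assms(1,2)] raise_u_def p1 p2 p3 p4 Z_def[symmetric] K f1 f2 f3 f4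
    by (rule cancel) (use d1 d2 d3 d4 in simp_all)
  have e: "Suc N - x = Suc (N - x)" using assms by simp
  have g: "qpoch (\<beta> * q) q (Suc (N - x)) = qpoch (\<beta> * q) q (N - x) * (1 - \<beta> * Z)"
    "qpoch (\<alpha> * inverse \<delta> * q) q (Suc (N - x))
      = qpoch (\<alpha> * inverse \<delta> * q) q (N - x) * (1 - \<alpha> * inverse \<delta> * Z)"
    by (simp_all add: qpoch_Suc Z_def mult_ac)
  have c: "lower_c \<alpha> \<beta> \<delta> q N x = (1 - \<alpha> * inverse \<delta> * Z) * (1 - \<beta> * Z)
      * (\<delta> * (X * q / Z) / (1 - \<delta> * (X * q / Z)))"
    unfolding lower_c_def p3 p5 K2 K3 f5 by simp
  have "weight \<alpha> \<beta> \<delta> (Suc N) q x * raise_u \<delta> q N x = qpoch (\<alpha> * q) q x * qpoch (\<beta> * \<delta> * q) q x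
    * qpoch (\<beta> * q) q (Suc (N - x)) * qpoch (\<alpha> * inverse \<delta> * q) q (Suc (N - x))
    * (weight_base \<delta> (Suc N) q x * raise_u \<delta> q N x)"
    by (simp only: weight_eq[OF nz(3) assms(3) nz(4)] e mult.assoc)
  then show ?thesis
    unfolding base g c by (simp add: weight_eq[OF nz(3) assms(3) nz(4)] mult_ac)
qed

text \<open>The other half: the coefficients of f(x) g(x + 1). The numerator of
  \<open>lower_a\<close> consists of the factors by which (\<alpha> q; q)_x and (\<beta> \<delta> q;
  q)_x grow when x becomes x + 1.\<close>

lemma weight_raise_v:
  assumes "regular \<delta> q (Suc N)" and "x \<le> N" and "\<beta> \<noteq> 0"
  shows "weight \<alpha> \<beta> \<delta> (Suc N) q (Suc x) * raise_v \<delta> q N (Suc x)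
    = - (weight \<alpha> \<beta> \<delta> N q x * lower_a \<alpha> \<beta> \<delta> q N x)"
proof -
  note r = regularD[OF assms(1)]
  define X where "X = q ^ Suc x"
  define K where "K = q ^ Suc N"
  have nz: "X \<noteq> 0" "K \<noteq> 0" "q \<noteq> 0" "\<delta> \<noteq> 0" using r by (auto simp: X_def K_def)
  have p0: "q powi (- int N - 1) = 1 / K"
    unfolding K_def using powi_nat_diff[of q "- int N - 1" 0 "Suc N"] r by simp
  have p1: "q powi (int N - 1 - 2 * int x) = K / X\<^sup>2"
    unfolding X_def K_def power_mult[symmetric] by (rule powi_nat_diff) (use r assms in auto)
  have p2: "q powi (int N - 2 * int x) = K * q / X\<^sup>2"
    unfolding X_def K_def power_mult[symmetric] power_Suc2[symmetric]
    by (rule powi_nat_diff) (use r assms in auto)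
  have p4: "q powi (2 * int (Suc x) - int N - 1) = X\<^sup>2 / K"
    unfolding X_def K_def power_mult[symmetric] by (rule powi_nat_diff) (use r assms in auto)
  have p5: "q powi (2 * int x - int N) = X\<^sup>2 / (K * q)"
    unfolding X_def K_def power_mult[symmetric] power_Suc2[symmetric]
    by (rule powi_nat_diff) (use r assms in auto)
  have d1: "1 - \<delta> * (X\<^sup>2 / K) \<noteq> 0"
    using r(4)[of "2 * int (Suc x) - int N - 1"] assms(2) unfolding p4 by simp
  have d2: "1 - \<delta> * (X\<^sup>2 / (K * q)) \<noteq> 0" using r(4)[of "2 * int x - int N"] assms by (simp add: p5)
  have d3: "1 - X \<noteq> 0" unfolding X_def using r(2) by simp
  have d4: "1 - \<delta> * X \<noteq> 0"
    unfolding X_def using r(4)[of "int (Suc x)"] assms(2)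
    by (simp only: power_int_of_nat) auto
  have f1: "1 - inverse \<delta> * (K / X\<^sup>2) = - K / (\<delta> * X\<^sup>2) * (1 - \<delta> * (X\<^sup>2 / K))"
    using nz by (simp add: field_simps)
  have f2: "1 - inverse \<delta> * (K * q / X\<^sup>2) = - K * q / (\<delta> * X\<^sup>2) * (1 - \<delta> * (X\<^sup>2 / (K * q)))"
    using nz by (simp add: field_simps)
  have f3: "1 - inverse \<delta> / X = - (1 - \<delta> * X) / (\<delta> * X)" using nz by (simp add: field_simps)
  have cancel: "g * (K * q * (- K / (\<delta> * X\<^sup>2) * u) * (- inverse \<delta> / X)
        / (- K * q / (\<delta> * X\<^sup>2) * w * a * (- b / (\<delta> * X))))
      * (1 / K * a * b / u) = g / w"
    if "u \<noteq> 0" "w \<noteq> 0" "a \<noteq> 0" "b \<noteq> 0" for g u w a b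
    using that nz by (simp add: field_simps)
  have base: "weight_base \<delta> (Suc N) q (Suc x) * raise_v \<delta> q N (Suc x)
      = weight_base \<delta> N q x / (1 - \<delta> * (X\<^sup>2 / (K * q)))"
    unfolding weight_base_Suc_Suc[OF assms(1,2)] raise_v_def p0 p1 p2 p4
      X_def[symmetric] K_def[symmetric] f1 f2 f3
    by (rule cancel) (use d1 d2 d3 d4 in simp_all)
  have e: "Suc N - Suc x = N - x" using assms by simp
  have g: "qpoch (\<alpha> * q) q (Suc x) = qpoch (\<alpha> * q) q x * (1 - \<alpha> * X)"
    "qpoch (\<beta> * \<delta> * q) q (Suc x) = qpoch (\<beta> * \<delta> * q) q x * (1 - \<beta> * \<delta> * X)"
    by (simp_all add: qpoch_Suc X_def mult_ac)
  have c: "lower_a \<alpha> \<beta> \<delta> q N x = - ((1 - \<alpha> * X) * (1 - \<beta> * \<delta> * X) / (1 - \<delta> * (X\<^sup>2 / (K * q))))"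
    unfolding lower_a_def p5 X_def by simp
  have "weight \<alpha> \<beta> \<delta> (Suc N) q (Suc x) * raise_v \<delta> q N (Suc x)
    = qpoch (\<alpha> * q) q (Suc x) * qpoch (\<beta> * \<delta> * q) q (Suc x)
    * qpoch (\<beta> * q) q (N - x) * qpoch (\<alpha> * inverse \<delta> * q) q (N - x)
    * (weight_base \<delta> (Suc N) q (Suc x) * raise_v \<delta> q N (Suc x))"
    by (simp only: weight_eq[OF nz(3) assms(3) nz(4)] e mult.assoc)
  then show ?thesis
    unfolding base g c by (simp add: weight_eq[OF nz(3) assms(3) nz(4)] mult_ac)
qed

text \<open>Summation by parts: the v-term of R_N is reindexed from x to x + 1, and no boundary term
  arises because v vanishes at 0 and u at N + 1. The two weight identities then match the sums term
  by term.\<close>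

lemma bilinear_V_raising:
  assumes "regular \<delta> q (Suc N)" and "\<beta> \<noteq> 0"
  shows "bilinear_V \<alpha> \<beta> \<delta> (Suc N) q (raising \<delta> q N f) g
    = - bilinear_V \<alpha> \<beta> \<delta> N q f (lowering \<alpha> \<beta> \<delta> q N g)"
proof -
  note r = regularD[OF assms(1)]
  define W where "W = weight \<alpha> \<beta> \<delta> (Suc N) q"
  define w where "w = weight \<alpha> \<beta> \<delta> N q"
  define u where "u = raise_u \<delta> q N"
  define v where "v = raise_v \<delta> q N"
  have "bilinear_V \<alpha> \<beta> \<delta> (Suc N) q (raising \<delta> q N f) g
      = W 0 * (u 0 * f 0) * g 0 + (\<Sum>x\<le>N. W (Suc x) * raising \<delta> q N f (Suc x) * g (Suc x))"
    unfolding bilinear_V_def by (subst sum.atMost_Suc_shift) (simp add: raising_0 W_def u_def)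
  also have "(\<Sum>x\<le>N. W (Suc x) * raising \<delta> q N f (Suc x) * g (Suc x))
      = (\<Sum>x\<le>N. W (Suc x) * (u (Suc x) * f (Suc x) + v (Suc x) * f x) * g (Suc x))"
    by (rule sum.cong) (simp_all add: raising_Suc r u_def v_def)
  also have "\<dots> = (\<Sum>x\<le>N. W (Suc x) * u (Suc x) * f (Suc x) * g (Suc x))
      + (\<Sum>x\<le>N. W (Suc x) * v (Suc x) * f x * g (Suc x))"
    unfolding sum.distrib[symmetric] by (rule sum.cong) (simp_all add: algebra_simps)
  finally have "bilinear_V \<alpha> \<beta> \<delta> (Suc N) q (raising \<delta> q N f) g
      = (\<Sum>x\<le>Suc N. W x * u x * f x * g x) + (\<Sum>x\<le>N. W (Suc x) * v (Suc x) * f x * g (Suc x))"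
    by (subst sum.atMost_Suc_shift) (simp add: mult.assoc)
  also have "(\<Sum>x\<le>Suc N. W x * u x * f x * g x) = (\<Sum>x\<le>N. W x * u x * f x * g x)"
    by (simp add: u_def raise_u_top r)
  also have "\<dots> = (\<Sum>x\<le>N. - (w x * lower_c \<alpha> \<beta> \<delta> q N x) * f x * g x)"
    by (rule sum.cong) (simp_all add: weight_raise_u[OF assms(1) _ assms(2)] W_def u_def w_def)
  also have "(\<Sum>x\<le>N. W (Suc x) * v (Suc x) * f x * g (Suc x))
      = (\<Sum>x\<le>N. - (w x * lower_a \<alpha> \<beta> \<delta> q N x) * f x * g (Suc x))"
    by (rule sum.cong) (simp_all add: weight_raise_v[OF assms(1) _ assms(2)] W_def v_def w_def)
  finally show ?thesis
    unfolding bilinear_V_def sum.distrib[symmetric] sum_negf[symmetric]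
    by (simp add: lowering_def w_def algebra_simps)
qed


lemma bilinear_V_cong:
  assumes "\<And>x. x \<le> N \<Longrightarrow> f x = f' x" "\<And>x. x \<le> N \<Longrightarrow> g x = g' x"
  shows "bilinear_V \<alpha> \<beta> \<delta> N q f g = bilinear_V \<alpha> \<beta> \<delta> N q f' g'"
  unfolding bilinear_V_def using assms by (intro sum.cong) auto

lemma bilinear_V_scale:
  "bilinear_V \<alpha> \<beta> \<delta> N q (\<lambda>x. a * f x) (\<lambda>x. b * g x) = a * b * bilinear_V \<alpha> \<beta> \<delta> N q f g"
  unfolding bilinear_V_def sum_distrib_left by (rule sum.cong) (simp_all add: mult_ac)

lemma bilinear_V_commute: "bilinear_V \<alpha> \<beta> \<delta> N q f g = bilinear_V \<alpha> \<beta> \<delta> N q g f"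
  unfolding bilinear_V_def by (rule sum.cong) (simp_all add: mult_ac)

text \<open>In basic hypergeometric terms this is the terminating very-well-poised 6phi5 sum. The
  adjoint relation with f = g = 1, where R 1 and L 1 are the constants g and - h, says that g times
  the mass at level N + 1 is h times the mass at level N.\<close>

lemma sum_weight:
  assumes "regular \<delta> q N" and "\<beta> \<noteq> 0"
  shows "(\<Sum>x\<le>N. weight \<alpha> \<beta> \<delta> N q x)
    = q ^ (N * (N + 1) div 2) * qpoch (\<alpha> * \<beta> * q\<^sup>2) q N / qpoch q q N"
  using assms(1)
proof (induction N)
  case 0
  have "1 - inverse \<delta> \<noteq> 0" using regular_inverse[OF 0, of 0] by simp
  then show ?case by (simp add: weight_def qpoch_Suc)
next
  case (Suc N)
  note r = regularD[OF Suc.prems]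
  define g where "g = q powi (- int N - 1) * (1 - q ^ Suc N)"
  define h where "h = 1 - \<alpha> * \<beta> * q ^ (N + 2)"
  have one: "(\<Sum>x\<le>M. weight \<alpha> \<beta> \<delta> M q x) = bilinear_V \<alpha> \<beta> \<delta> M q (\<lambda>_. 1) (\<lambda>_. 1)" for M
    by (simp add: bilinear_V_def)
  have R: "raising \<delta> q N (\<lambda>_. 1) x = g" if "x \<le> Suc N" for x
    using raise_u_plus_v[OF Suc.prems that] raising_Suc[OF r(1), of "x - 1" N \<delta> "\<lambda>_. 1"] that
    by (cases x) (simp_all add: raising_0 raise_v_0 g_def)
  have L: "lowering \<alpha> \<beta> \<delta> q N (\<lambda>_. 1) x = - h" if "x \<le> N" for x
    using lower_a_plus_c[OF regular_antimono[OF Suc.prems] that] by (simp add: lowering_def h_def)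
  have "g * bilinear_V \<alpha> \<beta> \<delta> (Suc N) q (\<lambda>_. 1) (\<lambda>_. 1)
      = bilinear_V \<alpha> \<beta> \<delta> (Suc N) q (raising \<delta> q N (\<lambda>_. 1)) (\<lambda>_. 1)"
    using bilinear_V_scale[of \<alpha> \<beta> \<delta> "Suc N" q g "\<lambda>_. 1" 1 "\<lambda>_. 1"]
    by (simp add: R cong: bilinear_V_cong)
  also have "\<dots> = - bilinear_V \<alpha> \<beta> \<delta> N q (\<lambda>_. 1) (lowering \<alpha> \<beta> \<delta> q N (\<lambda>_. 1))"
    by (rule bilinear_V_raising[OF Suc.prems assms(2)])
  also have "\<dots> = h * bilinear_V \<alpha> \<beta> \<delta> N q (\<lambda>_. 1) (\<lambda>_. 1)"
    using bilinear_V_scale[of \<alpha> \<beta> \<delta> N q 1 "\<lambda>_. 1" "- h" "\<lambda>_. 1"]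
    by (simp add: L cong: bilinear_V_cong)
  finally have eq: "g * bilinear_V \<alpha> \<beta> \<delta> (Suc N) q (\<lambda>_. 1) (\<lambda>_. 1)
    = h * bilinear_V \<alpha> \<beta> \<delta> N q (\<lambda>_. 1) (\<lambda>_. 1)" .
  have "q powi (- int N - 1) = 1 / q ^ Suc N"
    using powi_nat_diff[of q "- int N - 1" 0 "Suc N"] r by simp
  then have g: "g = (1 - q ^ Suc N) / q ^ Suc N" by (simp add: g_def)
  have g0: "1 - q ^ Suc N \<noteq> 0" "q ^ Suc N \<noteq> 0" using r(1) r(2)[of N] by auto
  have IH: "bilinear_V \<alpha> \<beta> \<delta> N q (\<lambda>_. 1) (\<lambda>_. 1)
      = q ^ (N * (N + 1) div 2) * qpoch (\<alpha> * \<beta> * q\<^sup>2) q N / qpoch q q N"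
    unfolding one[symmetric] by (rule Suc.IH[OF regular_antimono[OF Suc.prems]]) simp
  have s1: "qpoch (\<alpha> * \<beta> * q\<^sup>2) q (Suc N) = qpoch (\<alpha> * \<beta> * q\<^sup>2) q N * h"
    by (simp add: qpoch_Suc h_def power2_eq_square mult_ac)
  have s2: "qpoch q q (Suc N) = qpoch q q N * (1 - q ^ Suc N)" by (simp add: qpoch_Suc)
  have "Suc N * (Suc N + 1) div 2 = N * (N + 1) div 2 + Suc N" by simp
  then have s3: "q ^ (Suc N * (Suc N + 1) div 2) = q ^ (N * (N + 1) div 2) * q ^ Suc N"
    by (simp only: power_add)
  have "bilinear_V \<alpha> \<beta> \<delta> (Suc N) q (\<lambda>_. 1) (\<lambda>_. 1)
    = q ^ Suc N / (1 - q ^ Suc N) * (g * bilinear_V \<alpha> \<beta> \<delta> (Suc N) q (\<lambda>_. 1) (\<lambda>_. 1))"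
    unfolding g using g0 by (simp del: power_Suc)
  then show ?case
    unfolding one eq IH s1 s2 s3 by (simp add: mult_ac)
qed

section \<open>Reversal of q-shifted factorials and the norm of \<open>r_diag\<close>\<close>

definition reversal_factor :: "complex \<Rightarrow> complex \<Rightarrow> nat \<Rightarrow> nat \<Rightarrow> complex" where
  "reversal_factor c q n x = (\<Prod>i<x. - inverse c / q ^ (n - i))"

text \<open>Each factor obeys 1 - c^(-1) q^(-j) = - c^(-1) q^(-j) (1 - c q^j), and for j = n, ..., n
  - x + 1 the factors 1 - c q^j are those that (c q; q)_(n-x) lacks. The product form avoids
  dividing by (c q; q)_(n-x), which may vanish: the lemma is applied with c = \<beta> and c =
  \<alpha> / \<delta>.\<close>

lemma qpoch_reversal:
  assumes "q \<noteq> 0" "c \<noteq> 0" "x \<le> n"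
  shows "qpoch (inverse c * q powi (- int n)) q x * qpoch (c * q) q (n - x)
    = reversal_factor c q n x * qpoch (c * q) q n"
  using assms(3)
proof (induction x)
  case 0
  then show ?case by (simp add: reversal_factor_def)
next
  case (Suc x)
  obtain d where d: "n = Suc (x + d)" using Suc.prems less_iff_Suc_add[of x n] by auto
  have e: "n - x = Suc d" "n - Suc x = d" by (simp_all add: d)
  have p: "q powi (- int n) * q ^ x = 1 / q ^ Suc d"
  proof -
    have "q powi (- int n) = 1 / q ^ n" by (simp add: power_int_minus field_simps)
    moreover have "q ^ n = q ^ x * q ^ Suc d" by (simp add: d power_add)
    ultimately show ?thesis using assms(1) by simp
  qed
  have f: "1 - inverse c * q powi (- int n) * q ^ x = - inverse c / q ^ Suc d * (1 - c * q ^ Suc d)"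
    unfolding mult.assoc p using assms by (simp add: field_simps)
  have g: "qpoch (c * q) q (Suc d) = qpoch (c * q) q d * (1 - c * q ^ Suc d)"
    by (simp add: qpoch_Suc mult_ac)
  have "qpoch (inverse c * q powi (- int n)) q (Suc x) * qpoch (c * q) q (n - Suc x)
      = - inverse c / q ^ Suc d * (qpoch (inverse c * q powi (- int n)) q x * qpoch (c * q) q (n - x))"
    unfolding e qpoch_Suc[of _ _ x] f g by (simp only: mult_ac)
  also have "\<dots> = - inverse c / q ^ Suc d * (reversal_factor c q n x * qpoch (c * q) q n)"
    using Suc by simp
  also have "\<dots> = reversal_factor c q n (Suc x) * qpoch (c * q) q n"
    by (simp add: reversal_factor_def e)
  finally show ?case .
qed

text \<open>The last x factors of the full product are - c^(-1) q^(-j) with j = x, ..., 1; removing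
  them means multiplying by their inverses - c q^j.\<close>

lemma reversal_factor_complement:
  assumes "q \<noteq> 0" "c \<noteq> 0" "x \<le> n"
  shows "reversal_factor c q n (n - x) = reversal_factor c q n n * (\<Prod>i<x. - c * q ^ Suc i)"
  using assms(3)
proof (induction x)
  case (Suc x)
  obtain d where d: "n = Suc (x + d)" using Suc.prems less_iff_Suc_add[of x n] by auto
  have e: "n - x = Suc d" "n - Suc x = d" "n - d = Suc x" by (simp_all add: d)
  have "reversal_factor c q n (n - x) = reversal_factor c q n (n - Suc x) * (- inverse c / q ^ Suc x)"
    unfolding e by (simp add: reversal_factor_def e)
  then have "reversal_factor c q n (n - Suc x) = reversal_factor c q n (n - x) * (- c * q ^ Suc x)"
    using assms by (simp add: field_simps)
  then show ?case using Suc by simp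
qed simp

text \<open>At \<open>x = 0\<close> this reverses a whole symbol; with c = 1 it then evaluates
  (q^(-n); q)_n.\<close>

lemma qpoch_reversal':
  assumes "q \<noteq> 0" "c \<noteq> 0" "x \<le> n"
  shows "qpoch (inverse c * q powi (- int n)) q (n - x) * qpoch (c * q) q x
    = reversal_factor c q n n * (\<Prod>i<x. - c * q ^ Suc i) * qpoch (c * q) q n"
  using qpoch_reversal[OF assms(1,2), of "n - x" n] reversal_factor_complement[OF assms] assms
  by simp

lemma reversal_factor_nonzero: "q \<noteq> 0 \<Longrightarrow> c \<noteq> 0 \<Longrightarrow> reversal_factor c q n x \<noteq> 0"
  by (simp add: reversal_factor_def)

text \<open>The new parameters are read off from the numerator of \<open>r_diag\<close>, which has
  to become (\<alpha>' q; q)_x (\<beta>' \<delta> q; q)_x. One copy of it stays; the other combines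
  with (\<beta> q; q)_(n-x) (\<alpha> q / \<delta>; q)_(n-x) to constants and monomials by reversal.
  Of the squared denominator one copy cancels against the weight, and the other is reversed into the
  two symbols of length n - x of the primed weight.\<close>

lemma weight_r_diag_square:
  assumes "regular \<delta> q n" and "admissible \<alpha> \<beta> \<delta> q n" and "x \<le> n"
  defines "\<alpha>' \<equiv> inverse \<alpha> * \<delta> * q powi (- int n) / q"
    and "\<beta>' \<equiv> inverse (\<beta> * \<delta>) * q powi (- int n) / q"
  shows "weight \<alpha> \<beta> \<delta> n q x * (r_diag n \<alpha> \<beta> \<delta> q x)\<^sup>2
    = qpoch (\<beta> * q) q n * qpoch (\<alpha> * inverse \<delta> * q) q n
      / (reversal_factor \<alpha> q n n * qpoch (\<alpha> * q) q n
         * (reversal_factor (\<beta> * \<delta>) q n n * qpoch (\<beta> * \<delta> * q) q n))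
      * weight \<alpha>' \<beta>' \<delta> n q x"
proof -
  note r = regularD[OF assms(1)]
  have nz: "\<alpha> \<noteq> 0" "\<beta> \<noteq> 0" "\<delta> \<noteq> 0" "q \<noteq> 0" "\<alpha> * inverse \<delta> \<noteq> 0" "\<beta> * \<delta> \<noteq> 0" "\<beta>' \<noteq> 0"
    using assms r by (auto simp: admissible_def)
  have t: "\<alpha>' * q = inverse (\<alpha> * inverse \<delta>) * q powi (- int n)"
    "\<beta>' * \<delta> * q = inverse \<beta> * q powi (- int n)"
    "\<beta>' * q = inverse (\<beta> * \<delta>) * q powi (- int n)"
    "\<alpha>' * inverse \<delta> * q = inverse \<alpha> * q powi (- int n)"
    using nz by (simp_all add: \<alpha>'_def \<beta>'_def field_simps)
  define a where "a = qpoch (inverse (\<alpha> * inverse \<delta>) * q powi (- int n)) q x"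
  define b where "b = qpoch (inverse \<beta> * q powi (- int n)) q x"
  define A where "A = qpoch (inverse \<alpha> * q powi (- int n)) q (n - x)"
  define B where "B = qpoch (inverse (\<beta> * \<delta>) * q powi (- int n)) q (n - x)"
  define w where "w = weight_base \<delta> n q x"
  define t where "t = (\<alpha> * \<beta> * q ^ (n + 1)) ^ x"
  define u where "u = qpoch (\<alpha> * q) q x"
  define v where "v = qpoch (\<beta> * \<delta> * q) q x"
  define un where "un = qpoch (\<alpha> * q) q n"
  define vn where "vn = qpoch (\<beta> * \<delta> * q) q n"
  define y where "y = qpoch (\<beta> * q) q (n - x)"
  define z where "z = qpoch (\<alpha> * inverse \<delta> * q) q (n - x)"
  define yn where "yn = qpoch (\<beta> * q) q n"
  define zn where "zn = qpoch (\<alpha> * inverse \<delta> * q) q n"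
  define \<rho>1 where "\<rho>1 = reversal_factor \<alpha> q n n"
  define \<rho>2 where "\<rho>2 = reversal_factor (\<beta> * \<delta>) q n n"
  define \<sigma>1 where "\<sigma>1 = (\<Prod>i<x. - \<alpha> * q ^ Suc i)"
  define \<sigma>2 where "\<sigma>2 = (\<Prod>i<x. - (\<beta> * \<delta>) * q ^ Suc i)"
  have nz2: "u \<noteq> 0" "v \<noteq> 0" "un \<noteq> 0" "vn \<noteq> 0" "\<rho>1 \<noteq> 0" "\<rho>2 \<noteq> 0"
    using admissible_qpoch[OF assms(2)] assms(3) nz
    by (auto simp: u_def v_def un_def vn_def \<rho>1_def \<rho>2_def reversal_factor_nonzero)
  have e1: "b * y = reversal_factor \<beta> q n x * yn"
    unfolding b_def y_def yn_def by (rule qpoch_reversal) (use nz assms in auto)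
  have e2: "a * z = reversal_factor (\<alpha> * inverse \<delta>) q n x * zn"
    unfolding a_def z_def zn_def by (rule qpoch_reversal) (use nz assms in auto)
  have e3: "A * u = \<rho>1 * \<sigma>1 * un"
    unfolding A_def u_def un_def \<rho>1_def \<sigma>1_def by (rule qpoch_reversal') (use nz assms in auto)
  have e4: "B * v = \<rho>2 * \<sigma>2 * vn"
    unfolding B_def v_def vn_def \<rho>2_def \<sigma>2_def by (rule qpoch_reversal') (use nz assms in auto)
  \<comment> \<open>All powers depending on x cancel here. This is the purpose of the factor
    (\<alpha> \<beta> q^(n+1))^x in \<open>r_diag\<close>: its square balances the monomials
    produced by the four reversals.\<close>
  have key: "t\<^sup>2 * (reversal_factor \<beta> q n x * reversal_factor (\<alpha> * inverse \<delta>) q n x) = \<sigma>1 * \<sigma>2"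
  proof -
    have "t\<^sup>2 = (\<Prod>i<x. (\<alpha> * \<beta> * q ^ (n + 1))\<^sup>2)"
      by (simp add: t_def power_mult[symmetric] mult.commute)
    then have "t\<^sup>2 * (reversal_factor \<beta> q n x * reversal_factor (\<alpha> * inverse \<delta>) q n x)
      = (\<Prod>i<x. (\<alpha> * \<beta> * q ^ (n + 1))\<^sup>2 * ((- inverse \<beta> / q ^ (n - i)) * (- inverse (\<alpha> * inverse \<delta>) / q ^ (n - i))))"
      by (simp only: reversal_factor_def prod.distrib)
    also have "\<dots> = (\<Prod>i<x. (- \<alpha> * q ^ Suc i) * (- (\<beta> * \<delta>) * q ^ Suc i))"
    proof (rule prod.cong)
      fix i assume "i \<in> {..<x}"
      then have "n + 1 = (n - i) + Suc i" using assms by simp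
      then have "q ^ (n + 1) = q ^ (n - i) * q ^ Suc i" by (simp only: power_add)
      then show "(\<alpha> * \<beta> * q ^ (n + 1))\<^sup>2 * ((- inverse \<beta> / q ^ (n - i)) * (- inverse (\<alpha> * inverse \<delta>) / q ^ (n - i)))
          = (- \<alpha> * q ^ Suc i) * (- (\<beta> * \<delta>) * q ^ Suc i)"
        using nz by (simp add: power2_eq_square field_simps)
    qed simp
    finally show ?thesis by (simp only: \<sigma>1_def \<sigma>2_def prod.distrib)
  qed
  have rd: "r_diag n \<alpha> \<beta> \<delta> q x = t * (a * b) / (u * v)"
    unfolding r_diag_def t_def a_def b_def u_def v_def by simp
  have W: "weight \<alpha> \<beta> \<delta> n q x = u * v * y * z * w"
    unfolding weight_eq[OF nz(4,2,3)] u_def v_def y_def z_def w_def by simp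
  have W': "weight \<alpha>' \<beta>' \<delta> n q x = a * b * B * A * w"
    unfolding weight_eq[OF nz(4,7,3)] t a_def b_def A_def B_def w_def by simp
  have "weight \<alpha> \<beta> \<delta> n q x * (r_diag n \<alpha> \<beta> \<delta> q x)\<^sup>2
      = t\<^sup>2 * (a * z) * (b * y) * a * b * w / (u * v)"
    unfolding rd W using nz2 by (simp add: field_simps power2_eq_square)
  also have "\<dots> = (t\<^sup>2 * (reversal_factor \<beta> q n x * reversal_factor (\<alpha> * inverse \<delta>) q n x))
      * yn * zn * a * b * w / (u * v)"
    unfolding e1 e2 by (simp only: mult_ac)
  also have "\<dots> = yn * zn / (\<rho>1 * un * (\<rho>2 * vn)) * (a * b * (\<rho>2 * \<sigma>2 * vn / v) * (\<rho>1 * \<sigma>1 * un / u) * w)"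
    unfolding key using nz2 by (simp add: mult_ac)
  also have "\<rho>2 * \<sigma>2 * vn / v = B" unfolding e4[symmetric] using nz2 by simp
  also have "\<rho>1 * \<sigma>1 * un / u = A" unfolding e3[symmetric] using nz2 by simp
  finally show ?thesis
    unfolding W' yn_def zn_def \<rho>1_def \<rho>2_def un_def vn_def .
qed

definition racah_norm :: "complex \<Rightarrow> complex \<Rightarrow> complex \<Rightarrow> nat \<Rightarrow> complex \<Rightarrow> nat \<Rightarrow> complex" where
  "racah_norm \<alpha> \<beta> \<delta> N q n = q ^ (N * (N + 1) div 2) * (\<delta> * q powi (- int N)) ^ n
     * (qpoch (\<alpha> * \<beta> * q ^ (n + 1)) q (N + 1)
        * (qpoch q q n * qpoch (\<alpha> * inverse \<delta> * q) q n * qpoch (\<beta> * q) q n))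
     / ((1 - \<alpha> * \<beta> * q ^ (2 * n + 1)) * qpoch q q N
        * (qpoch (q powi (- int N)) q n * qpoch (\<beta> * \<delta> * q) q n * qpoch (\<alpha> * q) q n))"

lemma r_diag_norm:
  assumes "regular \<delta> q n" and "admissible \<alpha> \<beta> \<delta> q n" and "\<alpha> * \<beta> * q ^ (2 * n + 1) \<noteq> 1"
  shows "bilinear_V \<alpha> \<beta> \<delta> n q (r_diag n \<alpha> \<beta> \<delta> q) (r_diag n \<alpha> \<beta> \<delta> q) = racah_norm \<alpha> \<beta> \<delta> n q n"
proof -
  note r = regularD[OF assms(1)]
  define \<alpha>' where "\<alpha>' = inverse \<alpha> * \<delta> * q powi (- int n) / q"
  define \<beta>' where "\<beta>' = inverse (\<beta> * \<delta>) * q powi (- int n) / q"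
  have nz: "\<alpha> \<noteq> 0" "\<beta> \<noteq> 0" "\<delta> \<noteq> 0" "q \<noteq> 0" "\<beta>' \<noteq> 0" "\<alpha> * \<beta> * q ^ n \<noteq> 0" "\<beta> * \<delta> \<noteq> 0"
    using assms r by (auto simp: admissible_def \<beta>'_def)
  define un where "un = qpoch (\<alpha> * q) q n"
  define vn where "vn = qpoch (\<beta> * \<delta> * q) q n"
  define \<rho>1 where "\<rho>1 = reversal_factor \<alpha> q n n"
  define \<rho>2 where "\<rho>2 = reversal_factor (\<beta> * \<delta>) q n n"
  define \<rho>3 where "\<rho>3 = reversal_factor (\<alpha> * \<beta> * q ^ n) q n n"
  define \<rho>4 where "\<rho>4 = reversal_factor 1 q n n"
  define s where "s = qpoch (\<alpha> * \<beta> * q ^ (n + 1)) q n"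
  have nz2: "un \<noteq> 0" "vn \<noteq> 0" "\<rho>1 \<noteq> 0" "\<rho>2 \<noteq> 0" "\<rho>3 \<noteq> 0" "\<rho>4 \<noteq> 0" "qpoch q q n \<noteq> 0"
    using admissible_qpoch[OF assms(2)] nz qpoch_self_nonzero[of q, OF r(2)]
    by (auto simp: un_def vn_def \<rho>1_def \<rho>2_def \<rho>3_def \<rho>4_def reversal_factor_nonzero)
  have "bilinear_V \<alpha> \<beta> \<delta> n q (r_diag n \<alpha> \<beta> \<delta> q) (r_diag n \<alpha> \<beta> \<delta> q)
      = (\<Sum>x\<le>n. weight \<alpha> \<beta> \<delta> n q x * (r_diag n \<alpha> \<beta> \<delta> q x)\<^sup>2)"
    by (simp add: bilinear_V_def power2_eq_square mult.assoc)
  also have "\<dots> = (\<Sum>x\<le>n. qpoch (\<beta> * q) q n * qpoch (\<alpha> * inverse \<delta> * q) q n / (\<rho>1 * un * (\<rho>2 * vn))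
      * weight \<alpha>' \<beta>' \<delta> n q x)"
    unfolding \<rho>1_def \<rho>2_def un_def vn_def \<alpha>'_def \<beta>'_def
    by (rule sum.cong) (simp_all only: weight_r_diag_square[OF assms(1,2)] atMost_iff)
  also have "\<dots> = qpoch (\<beta> * q) q n * qpoch (\<alpha> * inverse \<delta> * q) q n / (\<rho>1 * un * (\<rho>2 * vn))
      * (q ^ (n * (n + 1) div 2) * qpoch (\<alpha>' * \<beta>' * q\<^sup>2) q n / qpoch q q n)"
    unfolding sum_distrib_left[symmetric] sum_weight[OF assms(1) nz(5)] ..
  \<comment> \<open>Since \<alpha>' \<beta>' q^2 = (\<alpha> \<beta>)^(-1) q^(-2n), reversal with c
    = \<alpha> \<beta> q^n turns the symbol in the total mass into (\<alpha> \<beta> q^(n+1);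
    q)_n.\<close>
  also have "qpoch (\<alpha>' * \<beta>' * q\<^sup>2) q n = \<rho>3 * s"
  proof -
    have e1: "\<alpha>' * \<beta>' * q\<^sup>2 = inverse (\<alpha> * \<beta> * q ^ n) * q powi (- int n)"
      using nz by (simp add: \<alpha>'_def \<beta>'_def power_int_minus field_simps power2_eq_square)
    have e2: "\<alpha> * \<beta> * q ^ (n + 1) = \<alpha> * \<beta> * q ^ n * q" by simp
    show ?thesis
      unfolding e1 s_def e2 \<rho>3_def using qpoch_reversal'[OF nz(4,6), of 0 n] by simp
  qed
  finally have lhs: "bilinear_V \<alpha> \<beta> \<delta> n q (r_diag n \<alpha> \<beta> \<delta> q) (r_diag n \<alpha> \<beta> \<delta> q)
    = qpoch (\<beta> * q) q n * qpoch (\<alpha> * inverse \<delta> * q) q n / (\<rho>1 * un * (\<rho>2 * vn))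
      * (q ^ (n * (n + 1) div 2) * (\<rho>3 * s) / qpoch q q n)" .
  \<comment> \<open>The last factor cancels the denominator 1 - \<alpha> \<beta> q^(2n+1) of the
    norm.\<close>
  have r1: "qpoch (\<alpha> * \<beta> * q ^ (n + 1)) q (n + 1) = s * (1 - \<alpha> * \<beta> * q ^ (2 * n + 1))"
    unfolding s_def Suc_eq_plus1[symmetric] qpoch_Suc mult_2 by (simp add: power_add mult_ac)
  have r2: "qpoch (q powi (- int n)) q n = \<rho>4 * qpoch q q n"
    using qpoch_reversal'[OF nz(4), of 1 0 n] by (simp add: \<rho>4_def)
  \<comment> \<open>The monomials left by the reversals combine to the power (\<delta> q^(-n))^n of
    the norm formula.\<close>
  have key: "\<rho>3 * \<rho>4 = (\<delta> * q powi (- int n)) ^ n * (\<rho>1 * \<rho>2)"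
  proof -
    have "(\<delta> * q powi (- int n)) ^ n = (\<Prod>i<n. \<delta> * q powi (- int n))" by simp
    then have "(\<delta> * q powi (- int n)) ^ n * (\<rho>1 * \<rho>2) = (\<Prod>i<n. \<delta> * q powi (- int n)
        * ((- inverse \<alpha> / q ^ (n - i)) * (- inverse (\<beta> * \<delta>) / q ^ (n - i))))"
      by (simp only: \<rho>1_def \<rho>2_def reversal_factor_def prod.distrib)
    also have "\<dots> = (\<Prod>i<n. (- inverse (\<alpha> * \<beta> * q ^ n) / q ^ (n - i)) * (- inverse 1 / q ^ (n - i)))"
      using nz by (intro prod.cong) (simp_all add: power_int_minus field_simps)
    finally show ?thesis by (simp only: \<rho>3_def \<rho>4_def reversal_factor_def prod.distrib)
  qed
  have "1 - \<alpha> * \<beta> * q ^ (2 * n + 1) \<noteq> 0" using assms(3) by simp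
  moreover have "\<rho>3 = (\<delta> * q powi (- int n)) ^ n * (\<rho>1 * \<rho>2) / \<rho>4"
    unfolding key[symmetric] using nz2 by simp
  ultimately show ?thesis
    unfolding lhs racah_norm_def r1 r2 un_def[symmetric] vn_def[symmetric]
    using nz2 by (simp add: mult_ac)
qed

section \<open>Orthogonality and norms at all levels\<close>

lemma bilinear_V_r_fun_Suc:
  assumes "n \<le> N" "m \<le> N" and "regular \<delta> q (Suc N)" and "admissible \<alpha> \<beta> \<delta> q (Suc N)"
  shows "bilinear_V \<alpha> \<beta> \<delta> (Suc N) q (r_fun n \<alpha> \<beta> \<delta> (Suc N) q) (r_fun m \<alpha> \<beta> \<delta> (Suc N) q)
    = (q ^ Suc N / (1 - q ^ Suc N))\<^sup>2 * (racah_eigenvalue \<alpha> \<beta> q (Suc N) - racah_eigenvalue \<alpha> \<beta> q m)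
      * bilinear_V \<alpha> \<beta> \<delta> N q (r_fun n \<alpha> \<beta> \<delta> N q) (r_fun m \<alpha> \<beta> \<delta> N q)"
proof -
  define f where "f = r_fun n \<alpha> \<beta> \<delta> N q"
  define g where "g = r_fun m \<alpha> \<beta> \<delta> N q"
  define c where "c = q ^ Suc N / (1 - q ^ Suc N)"
  define l where "l = racah_eigenvalue \<alpha> \<beta> q m - racah_eigenvalue \<alpha> \<beta> q (Suc N)"
  have b: "\<beta> \<noteq> 0" using assms by (simp add: admissible_def)
  have f: "r_fun n \<alpha> \<beta> \<delta> (Suc N) q = (\<lambda>x. c * raising \<delta> q N f x)"
    unfolding c_def f_def by (rule ext) (rule r_fun_Suc[OF assms(1)])
  have g: "r_fun m \<alpha> \<beta> \<delta> (Suc N) q = (\<lambda>x. c * raising \<delta> q N g x)"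
    unfolding c_def g_def by (rule ext) (rule r_fun_Suc[OF assms(2)])
  have LR: "lowering \<alpha> \<beta> \<delta> q N (raising \<delta> q N g) x = l * g x" if "x \<le> N" for x
  proof -
    have "racah_op \<alpha> \<beta> \<delta> N q g x = racah_eigenvalue \<alpha> \<beta> q m * g x"
      unfolding g_def
      by (rule racah_op_r_fun[OF assms(2) regular_antimono[OF assms(3)] admissible_antimono[OF assms(4)] that])
         (use assms in auto)
    then show ?thesis by (simp add: lowering_raising[OF assms(3) that] l_def algebra_simps)
  qed
  have inner: "bilinear_V \<alpha> \<beta> \<delta> N q f (lowering \<alpha> \<beta> \<delta> q N (raising \<delta> q N g)) = l * bilinear_V \<alpha> \<beta> \<delta> N q f g"
    using bilinear_V_scale[of \<alpha> \<beta> \<delta> N q 1 f l g] by (simp add: LR cong: bilinear_V_cong)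
  show ?thesis
    unfolding f g bilinear_V_scale bilinear_V_raising[OF assms(3) b] inner c_def[symmetric]
      f_def[symmetric] g_def[symmetric]
    by (simp add: l_def power2_eq_square algebra_simps)
qed

text \<open>At level n the function r_m with m < n is a multiple of an image under R_(n-1), while
  r_n is \<open>r_diag\<close>; the adjoint relation puts L on \<open>r_diag\<close>, which gives 0.
  Higher levels only multiply this 0 by a scalar.\<close>

lemma bilinear_V_r_fun_less:
  assumes "m < n" "n \<le> N" and "regular \<delta> q N" and "admissible \<alpha> \<beta> \<delta> q N"
  shows "bilinear_V \<alpha> \<beta> \<delta> N q (r_fun n \<alpha> \<beta> \<delta> N q) (r_fun m \<alpha> \<beta> \<delta> N q) = 0"
  using assms(2-)
proof (induction N rule: dec_induct)
  case base
  obtain k where k: "n = Suc k" "m \<le> k" using assms(1) by (cases n) auto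
  note r = regularD[OF base(1)]
  have b: "\<beta> \<noteq> 0" using base by (simp add: admissible_def)
  have f: "r_fun n \<alpha> \<beta> \<delta> n q = r_diag n \<alpha> \<beta> \<delta> q"
    by (rule r_fun_self) (rule qpoch_self_nonzero, rule r)
  define c where "c = q ^ Suc k / (1 - q ^ Suc k)"
  define g where "g = r_fun m \<alpha> \<beta> \<delta> k q"
  have g: "r_fun m \<alpha> \<beta> \<delta> n q = (\<lambda>x. c * raising \<delta> q k g x)"
    unfolding c_def g_def k by (rule ext) (rule r_fun_Suc[OF k(2)])
  have "bilinear_V \<alpha> \<beta> \<delta> n q (raising \<delta> q k g) (r_diag n \<alpha> \<beta> \<delta> q)
      = - bilinear_V \<alpha> \<beta> \<delta> k q g (lowering \<alpha> \<beta> \<delta> q k (r_diag n \<alpha> \<beta> \<delta> q))"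
    unfolding k by (rule bilinear_V_raising[OF base(1)[unfolded k] b])
  also have "\<dots> = 0"
    unfolding bilinear_V_def using lowering_r_diag[OF r(1) base(2)[unfolded k]] by (simp add: k)
  finally show ?case
    using bilinear_V_scale[of \<alpha> \<beta> \<delta> n q c "raising \<delta> q k g" 1 "r_diag n \<alpha> \<beta> \<delta> q"]
    unfolding f g by (subst bilinear_V_commute) simp
next
  case (step N)
  have "bilinear_V \<alpha> \<beta> \<delta> N q (r_fun n \<alpha> \<beta> \<delta> N q) (r_fun m \<alpha> \<beta> \<delta> N q) = 0"
    by (rule step.IH[OF regular_antimono[OF step.prems(1)] admissible_antimono[OF step.prems(2)]]) simp_all
  then show ?case
    using bilinear_V_r_fun_Suc[OF step.hyps(1) _ step.prems, of m] assms(1) step.hyps(1) by simp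
qed

lemma racah_eigenvalue_diff:
  assumes "q \<noteq> 0"
  shows "racah_eigenvalue \<alpha> \<beta> q M - racah_eigenvalue \<alpha> \<beta> q n
    = 1 / q ^ M * (1 - q ^ M / q ^ n) * (1 - \<alpha> * \<beta> * q ^ (M + n + 1))"
  using assms unfolding racah_eigenvalue_def
  by (simp add: power_int_minus power_add field_simps)

text \<open>The difference of the eigenvalues factors, and its factor 1 - \<alpha> \<beta> q^(N+n+2)
  is the one by which (\<alpha> \<beta> q^(n+1); q)_(N+1) grows. The other factors account for the
  change of (q; q)_N, of (q^(-N); q)_n and of the powers of q.\<close>

lemma racah_norm_Suc:
  assumes "n \<le> N" and "regular \<delta> q (Suc N)"
  shows "racah_norm \<alpha> \<beta> \<delta> (Suc N) q n
    = (q ^ Suc N / (1 - q ^ Suc N))\<^sup>2 * (racah_eigenvalue \<alpha> \<beta> q (Suc N) - racah_eigenvalue \<alpha> \<beta> q n)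
      * racah_norm \<alpha> \<beta> \<delta> N q n"
proof -
  note r = regularD[OF assms(2)]
  define A where "A = q ^ Suc N"
  define B where "B = q ^ n"
  have nz: "A \<noteq> 0" "B \<noteq> 0" "1 - A \<noteq> 0" using r(1) r(2)[of N] by (auto simp: A_def B_def)
  have "Suc N = n + Suc (N - n)" using assms by simp
  then have AB: "A = B * q ^ Suc (N - n)" unfolding A_def B_def by (metis power_add)
  then have AB': "A - B \<noteq> 0" using nz(2) r(2)[of "N - n"] by (auto simp del: power_Suc)
  have p: "q powi (- int (Suc N)) = 1 / A" "q powi (- int N) = q / A"
    unfolding A_def power_int_minus power_int_of_nat using r(1) by (simp_all add: field_simps)
  \<comment> \<open>Splitting (q^(-N-1); q)_(n+1) at its first and at its last factor relates
    (q^(-N); q)_n to (q^(-N-1); q)_n.\<close>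
  have "(1 - 1 / A) * qpoch (q powi (- int N)) q n = qpoch (1 / A) q (Suc n)"
    unfolding p by (simp add: qpoch_Suc_shift)
  also have "\<dots> = qpoch (q powi (- int (Suc N))) q n * (1 - B / A)"
    unfolding qpoch_Suc p(1) by (simp add: B_def)
  finally have e1: "qpoch (q powi (- int (Suc N))) q n = qpoch (q powi (- int N)) q n * ((A - 1) / (A - B))"
    using nz AB' by (simp add: field_simps)
  have "(1 / A) ^ n * B = (q / A) ^ n" by (simp add: B_def power_divide)
  then have e2: "(\<delta> * q powi (- int (Suc N))) ^ n = (\<delta> * q powi (- int N)) ^ n / B"
    unfolding p power_mult_distrib using nz by (simp add: field_simps)
  have e3: "qpoch (\<alpha> * \<beta> * q ^ (n + 1)) q (Suc N + 1)
      = qpoch (\<alpha> * \<beta> * q ^ (n + 1)) q (N + 1) * (1 - \<alpha> * \<beta> * q ^ (Suc N + n + 1))"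
    unfolding add_Suc qpoch_Suc[of _ _ "N + 1"] by (simp add: power_add mult_ac)
  have e4: "qpoch q q (Suc N) = qpoch q q N * (1 - A)" by (simp add: qpoch_Suc A_def)
  have "Suc N * (Suc N + 1) div 2 = N * (N + 1) div 2 + Suc N" by simp
  then have e5: "q ^ (Suc N * (Suc N + 1) div 2) = q ^ (N * (N + 1) div 2) * A"
    by (simp only: power_add A_def)
  have cancel: "(Q * A) * (D / B) * ((S * t) * P) / (T * (q' * (1 - A)) * ((R * ((A - 1) / (A - B))) * V * U))
      = (A / (1 - A))\<^sup>2 * (1 / A * (1 - A / B) * t) * (Q * D * (S * P) / (T * q' * (R * V * U)))"
    for Q D S t P T q' R V U
  proof -
    have "A * (1 / B) * t / ((1 - A) * ((A - 1) / (A - B))) = (A / (1 - A))\<^sup>2 * (1 / A * (1 - A / B) * t)"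
    proof -
      have e: "A - 1 = - (1 - A)" "1 - A / B = - (A - B) / B" using nz by (simp_all add: field_simps)
      have "A * (1 / B) * t / (u * (- u / w)) = (A / u)\<^sup>2 * (1 / A * (- w / B) * t)"
        if "u \<noteq> 0" "w \<noteq> 0" for u w
        using that nz by (simp add: field_simps power2_eq_square)
      then show ?thesis unfolding e using nz(3) AB' .
    qed
    moreover have "(Q * A) * (D / B) * ((S * t) * P) / (T * (q' * i) * ((R * w) * V * U))
        = A * (1 / B) * t / (i * w) * (Q * D * (S * P) / (T * q' * (R * V * U)))" for i w
      by (simp add: mult_ac)
    ultimately show ?thesis by (simp only:)
  qed
  show ?thesis
    unfolding racah_norm_def e1 e2 e3 e4 e5 racah_eigenvalue_diff[OF r(1)] A_def[symmetric] B_def[symmetric]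
    by (rule cancel)
qed

lemma r_fun_norm:
  assumes "n \<le> N" and "regular \<delta> q N" and "admissible \<alpha> \<beta> \<delta> q N"
    and "\<alpha> * \<beta> * q ^ (2 * n + 1) \<noteq> 1"
  shows "bilinear_V \<alpha> \<beta> \<delta> N q (r_fun n \<alpha> \<beta> \<delta> N q) (r_fun n \<alpha> \<beta> \<delta> N q) = racah_norm \<alpha> \<beta> \<delta> N q n"
  using assms(1-3)
proof (induction N rule: dec_induct)
  case base
  have "r_fun n \<alpha> \<beta> \<delta> n q = r_diag n \<alpha> \<beta> \<delta> q"
    by (rule r_fun_self) (rule qpoch_self_nonzero, rule regularD[OF base(1)])
  then show ?case using r_diag_norm[OF base assms(4)] by simp
next
  case (step N)
  have "bilinear_V \<alpha> \<beta> \<delta> N q (r_fun n \<alpha> \<beta> \<delta> N q) (r_fun n \<alpha> \<beta> \<delta> N q) = racah_norm \<alpha> \<beta> \<delta> N q n"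
    by (rule step.IH[OF regular_antimono[OF step.prems(1)] admissible_antimono[OF step.prems(2)]]) simp_all
  then show ?case
    by (simp only: bilinear_V_r_fun_Suc[OF step.hyps(1,1) step.prems]
        racah_norm_Suc[OF step.hyps(1) step.prems(1)])
qed

subsection \<open>The explicit formula\<close>

text \<open>
  Unlike \<open>qbinom\<close>, whose subtraction is truncated, this vanishes for \<open>0 \<le> a < k\<close>. The sum in the
  explicit formula can therefore run over all \<open>y \<le> n\<close>.
\<close>

definition qbinom_int :: "complex \<Rightarrow> int \<Rightarrow> nat \<Rightarrow> complex" where
  "qbinom_int q a k = qpoch (q powi (a - int k + 1)) q k / qpoch q q k"

lemma qbinom_int_eq:
  assumes "k \<le> m"
  shows "qbinom_int q (int m) k = qbinom q m k"
proof -
  have "int m - int k + 1 = int (m - k + 1)" using assms by simp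
  then show ?thesis unfolding qbinom_int_def qbinom_def by (simp only: power_int_of_nat)
qed

lemma qbinom_int_eq_0:
  assumes "q \<noteq> 0" "m < k"
  shows "qbinom_int q (int m) k = 0"
proof -
  have "int m - int k + 1 = - int (k - 1 - m)" using assms by simp
  then have "q powi (int m - int k + 1) * q ^ (k - 1 - m) = 1"
    using assms(1) by (simp only: power_int_minus power_int_of_nat) simp
  moreover have "k - 1 - m < k" using assms by simp
  ultimately have "qpoch (q powi (int m - int k + 1)) q k = 0"
    unfolding qpoch_def by (intro prod_zero) (auto intro!: bexI[of _ "k - 1 - m"])
  then show ?thesis by (simp add: qbinom_int_def)
qed

text \<open>With c = q^(a-k) both sides come from splitting (c; q)_(k+1) at its first or last
  factor. No quotient of coefficients is formed, so zeros of either side cause no exception.\<close>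

lemma qbinom_int_step:
  assumes "q \<noteq> 0"
  shows "(1 - q powi a) * qbinom_int q (a - 1) k = (1 - q powi a / q ^ k) * qbinom_int q a k"
proof -
  define c where "c = q powi (a - int k)"
  have c: "c = q powi a / q ^ k"
    unfolding c_def by (simp only: power_int_diff[OF disjI1[OF assms]] power_int_of_nat)
  have e: "q powi (a - int k + 1) = c * q" "a - 1 - int k + 1 = a - int k"
    unfolding c_def using assms by (simp_all add: power_int_add)
  have "(1 - c) * qpoch (c * q) q k = qpoch c q k * (1 - c * q ^ k)"
    by (metis qpoch_Suc qpoch_Suc_shift)
  also have "c * q ^ k = q powi a" unfolding c using assms by simp
  finally show ?thesis
    unfolding qbinom_int_def e c_def[symmetric] c[symmetric] by (simp add: mult_ac)
qed

text \<open>The coefficient of \<open>r_diag\<close> at \<open>y\<close> in the explicit sum, up to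
  the common prefactor. The argument \<open>x\<close> is an integer because the recursion in the
  level refers to x - 1, also at x = 0.\<close>

definition raise_kernel :: "complex \<Rightarrow> complex \<Rightarrow> nat \<Rightarrow> nat \<Rightarrow> int \<Rightarrow> nat \<Rightarrow> complex" where
  "raise_kernel \<delta> q n N x y =
     qbinom_int q (int N - x) (n - y) * qbinom_int q x y
     * (qpoch (\<delta> * q powi (x - int N)) q y
        * qpoch (\<delta> * q powi (x - int n + int y + 1)) q (n - y)
        / qpoch (\<delta> * q powi (int y - int n)) q (n + 1))
     * (1 - \<delta> * q powi (2 * int y - int n))
     * q powi (int y * (int y + int N - x - int n))"

text \<open>The left side is R_N acting in x for fixed y, multiplied by M (1 - \<delta> X^2 / M) to
  clear denominators. Its prefactors convert every symbol of the two kernels into that of level N +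
  1, which leaves a rational identity in X, Y, M, Z and \<delta>.\<close>

lemma raise_kernel_step:
  fixes x :: int and n N y :: nat
  assumes "q \<noteq> 0" "y \<le> n"
  defines "X \<equiv> q powi x" and "M \<equiv> q ^ Suc N" and "Z \<equiv> q ^ n"
  shows "- M * (1 - X / M) * (1 - \<delta> * (X / M)) * raise_kernel \<delta> q n N x y
      + (1 - X) * (1 - \<delta> * X) * raise_kernel \<delta> q n N (x - 1) y
    = (1 - M / Z) * (1 - \<delta> * (X\<^sup>2 / M)) * raise_kernel \<delta> q n (Suc N) x y"
proof -
  define Y where "Y = q ^ y"
  have nz: "X \<noteq> 0" "M \<noteq> 0" "Z \<noteq> 0" "Y \<noteq> 0" using assms by (auto simp: X_def M_def Z_def Y_def)
  note pd = power_int_diff[OF disjI1[OF assms(1)]] power_int_add[OF disjI1[OF assms(1)]]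
  define g1 where "g1 = qbinom_int q (int (Suc N) - x) (n - y)"
  define g2 where "g2 = qbinom_int q x y"
  define h1 where "h1 = qpoch (\<delta> * q powi (x - int (Suc N))) q y"
  define h2 where "h2 = qpoch (\<delta> * q powi (x - int n + int y + 1)) q (n - y)"
  define P where "P = q powi (int y * (int y + int (Suc N) - x - int n))"
  define R where "R = (1 - \<delta> * q powi (2 * int y - int n)) / qpoch (\<delta> * q powi (int y - int n)) q (n + 1)"
  have k0: "raise_kernel \<delta> q n (Suc N) x y = g1 * g2 * h1 * h2 * P * R"
    by (simp add: raise_kernel_def g1_def g2_def h1_def h2_def P_def R_def)
  have Zy: "q ^ (n - y) = Z / Y" using assms by (simp add: Z_def Y_def power_diff)
  have a1: "(1 - M / X) * qbinom_int q (int N - x) (n - y) = (1 - M * Y / (X * Z)) * g1"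
  proof -
    have "int (Suc N) - x - 1 = int N - x" by simp
    moreover have "q powi (int (Suc N) - x) = M / X"
      unfolding pd M_def X_def by (simp only: power_int_of_nat)
    ultimately show ?thesis
      using qbinom_int_step[OF assms(1), of "int (Suc N) - x" "n - y"] Zy
      by (simp add: g1_def mult_ac)
  qed
  have a2: "(1 - X) * qbinom_int q (x - 1) y = (1 - X / Y) * g2"
    using qbinom_int_step[OF assms(1), of x y] by (simp add: X_def Y_def g2_def)
  have xM: "q powi (x - int (Suc N)) = X / M"
    unfolding pd M_def X_def by (simp only: power_int_of_nat)
  have b1: "(1 - \<delta> * (X / M)) * qpoch (\<delta> * q powi (x - int N)) q y = h1 * (1 - \<delta> * (X * Y / M))"
  proof -
    have "x - int N = (x - int (Suc N)) + 1" by simp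
    then have e: "q powi (x - int N) = X / M * q" using xM by (simp only: pd) simp
    show ?thesis
      unfolding h1_def xM Y_def e
      using qpoch_Suc[of "\<delta> * (X / M)" q y] qpoch_Suc_shift[of "\<delta> * (X / M)" q y]
      by (simp add: mult_ac)
  qed
  have b2: "(1 - \<delta> * X) * qpoch (\<delta> * q powi (x - 1 - int n + int y + 1)) q (n - y)
      = (1 - \<delta> * (X * Y / Z)) * h2"
  proof -
    have e0: "x - 1 - int n + int y + 1 = x - int n + int y" by simp
    have e1: "q powi (x - int n + int y) = X * Y / Z"
      unfolding pd by (simp only: power_int_of_nat X_def Y_def Z_def) simp
    have e2: "q powi (x - int n + int y + 1) = X * Y / Z * q"
      unfolding pd by (simp only: power_int_of_nat X_def Y_def Z_def) simp
    have e3: "\<delta> * (X * Y / Z) * q ^ (n - y) = \<delta> * X"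
      unfolding Zy using nz by simp
    have "(1 - \<delta> * X) * qpoch (\<delta> * (X * Y / Z)) q (n - y)
        = (1 - \<delta> * (X * Y / Z)) * qpoch (\<delta> * (X * Y / Z) * q) q (n - y)"
      by (metis e3 mult.commute qpoch_Suc qpoch_Suc_shift)
    then show ?thesis
      unfolding h2_def e0 e1 e2 mult.assoc .
  qed
  have c1: "q powi (int y * (int y + int N - x - int n)) = P / Y"
  proof -
    have "int y * (int y + int N - x - int n) = int y * (int y + int (Suc N) - x - int n) - int y"
      by (simp add: algebra_simps)
    then show ?thesis by (simp only: pd P_def Y_def power_int_of_nat)
  qed
  have c2: "q powi (int y * (int y + int N - (x - 1) - int n)) = P"
    by (simp add: P_def algebra_simps)
  have c3: "x - 1 - int N = x - int (Suc N)" "int N - (x - 1) = int (Suc N) - x" by auto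
  have "- M * (1 - X / M) * (1 - \<delta> * (X / M)) * raise_kernel \<delta> q n N x y
      = X * ((1 - M / X) * qbinom_int q (int N - x) (n - y)) * g2
        * ((1 - \<delta> * (X / M)) * qpoch (\<delta> * q powi (x - int N)) q y) * h2 * (P / Y) * R"
  proof -
    have "- M * (1 - X / M) = X * (1 - M / X)" using nz by (simp add: field_simps)
    then show ?thesis
      unfolding raise_kernel_def c1 by (simp add: g2_def h2_def R_def mult_ac)
  qed
  also have "\<dots> = (X / Y * (1 - M * Y / (X * Z)) * (1 - \<delta> * (X * Y / M))) * (g1 * g2 * h1 * h2 * P * R)"
    unfolding a1 b1 by simp
  finally have t1: "- M * (1 - X / M) * (1 - \<delta> * (X / M)) * raise_kernel \<delta> q n N x y
    = (X / Y * (1 - M * Y / (X * Z)) * (1 - \<delta> * (X * Y / M))) * (g1 * g2 * h1 * h2 * P * R)" .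
  have "(1 - X) * (1 - \<delta> * X) * raise_kernel \<delta> q n N (x - 1) y
      = g1 * ((1 - X) * qbinom_int q (x - 1) y) * h1
        * ((1 - \<delta> * X) * qpoch (\<delta> * q powi (x - 1 - int n + int y + 1)) q (n - y)) * P * R"
    unfolding raise_kernel_def c2 c3 by (simp add: g1_def h1_def R_def)
  also have "\<dots> = ((1 - X / Y) * (1 - \<delta> * (X * Y / Z))) * (g1 * g2 * h1 * h2 * P * R)"
    unfolding a2 b2 by simp
  finally have t2: "(1 - X) * (1 - \<delta> * X) * raise_kernel \<delta> q n N (x - 1) y
    = ((1 - X / Y) * (1 - \<delta> * (X * Y / Z))) * (g1 * g2 * h1 * h2 * P * R)" .
  \<comment> \<open>Y drops out on the right. This is decisive: the scalar is the same for every y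
    and can be taken out of the sum over y.\<close>
  have "X / Y * (1 - M * Y / (X * Z)) * (1 - \<delta> * (X * Y / M)) + (1 - X / Y) * (1 - \<delta> * (X * Y / Z))
      = (1 - M / Z) * (1 - \<delta> * (X\<^sup>2 / M))"
    using nz by (simp add: field_simps power2_eq_square)
  then show ?thesis
    unfolding t1 t2 k0 distrib_right[symmetric] by simp
qed

lemma qpoch_add: "qpoch a q (k + l) = qpoch a q k * qpoch (a * q ^ k) q l"
  by (induction l) (simp_all add: qpoch_Suc power_add mult.assoc)

text \<open>The two binomials force y \<le> x and n - y \<le> n - x, hence y = x. There (\<delta>
  q^(x-n); q)_(n+1) splits into a symbol of length x, the single factor 1 - \<delta> q^(2x-n) and a
  symbol of length n - x, which are exactly the factors of the numerator.\<close>

lemma raise_kernel_self: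
  assumes "regular \<delta> q n" "x \<le> n" "y \<le> n"
  shows "raise_kernel \<delta> q n n (int x) y = (if y = x then 1 else 0)"
proof (cases "y = x")
  case False
  note r = regularD[OF assms(1)]
  have "qbinom_int q (int n - int x) (n - y) = 0 \<or> qbinom_int q (int x) y = 0"
  proof (cases "x < y")
    case True
    then show ?thesis using qbinom_int_eq_0[OF r(1)] by blast
  next
    case f: False
    have "int n - int x = int (n - x)" using assms by simp
    moreover have "n - x < n - y" using f False assms by simp
    ultimately show ?thesis using qbinom_int_eq_0[OF r(1)] by metis
  qed
  then show ?thesis using False by (auto simp: raise_kernel_def)
next
  case True
  note r = regularD[OF assms(1)]
  have q1: "qbinom_int q (int m) m = 1" for m
    using qpoch_self_nonzero[of q m, OF r(2)] by (simp add: qbinom_int_def)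
  have nx: "int n - int x = int (n - x)" using assms by simp
  define a where "a = \<delta> * q powi (int x - int n)"
  have e1: "a * q ^ x = \<delta> * q powi (2 * int x - int n)"
  proof -
    have e: "2 * int x - int n = (int x - int n) + int x" by simp
    show ?thesis
      unfolding a_def e power_int_add[OF disjI1[OF r(1)]] power_int_of_nat mult.assoc ..
  qed
  have e2: "a * q ^ Suc x = \<delta> * q powi (int x - int n + int x + 1)"
    unfolding a_def power_int_add[OF disjI1[OF r(1)]] power_int_of_nat
    by (simp add: mult_ac)
  have "n + 1 = Suc x + (n - x)" using assms by simp
  then have S: "qpoch a q (n + 1) = qpoch a q x * (1 - \<delta> * q powi (2 * int x - int n))
      * qpoch (\<delta> * q powi (int x - int n + int x + 1)) q (n - x)"
    by (simp only: qpoch_add qpoch_Suc e1 e2)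
  have "qpoch a q (n + 1) \<noteq> 0"
  proof (rule qpoch_nonzero)
    fix i assume "i < n + 1"
    then have "1 - \<delta> * q powi (int x - int n + int i) \<noteq> 0"
      by (intro r(4)) (use assms in auto)
    then show "a * q ^ i \<noteq> 1"
      unfolding a_def by (simp add: power_int_add[OF disjI1[OF r(1)]] mult_ac)
  qed
  then have nz: "qpoch a q x \<noteq> 0" "1 - \<delta> * q powi (2 * int x - int n) \<noteq> 0"
     "qpoch (\<delta> * q powi (int x - int n + int x + 1)) q (n - x) \<noteq> 0"
    unfolding S by auto
  have "raise_kernel \<delta> q n n (int x) x = qpoch a q x
      * qpoch (\<delta> * q powi (int x - int n + int x + 1)) q (n - x)
      / qpoch a q (n + 1) * (1 - \<delta> * q powi (2 * int x - int n))"
    unfolding raise_kernel_def nx q1 a_def by simp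
  also have "\<dots> = 1" unfolding S using nz by simp
  finally show ?thesis using True by simp
qed

lemma r_fun_eq_kernel_sum:
  assumes "n \<le> N" "regular \<delta> q N" "x \<le> N"
  shows "r_fun n \<alpha> \<beta> \<delta> N q x = qpoch q q n / qpoch (q ^ (N - n + 1)) q n
    * (\<Sum>y\<le>n. raise_kernel \<delta> q n N (int x) y * r_diag n \<alpha> \<beta> \<delta> q y)"
  using assms
proof (induction N arbitrary: x rule: dec_induct)
  case base
  have nz: "qpoch q q n \<noteq> 0" by (rule qpoch_self_nonzero) (rule regularD[OF base(1)])
  have "(\<Sum>y\<le>n. raise_kernel \<delta> q n n (int x) y * r_diag n \<alpha> \<beta> \<delta> q y)
      = (\<Sum>y\<le>n. if y = x then r_diag n \<alpha> \<beta> \<delta> q y else 0)"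
    by (rule sum.cong) (simp_all add: raise_kernel_self base)
  then show ?case using base nz by (simp add: r_fun_self)
next
  case (step N)
  note r = regularD[OF step.prems(1)]
  define f where "f = r_diag n \<alpha> \<beta> \<delta> q"
  define G where "G x = (\<Sum>y\<le>n. raise_kernel \<delta> q n N x y * f y)" for x
  define \<kappa> where "\<kappa> = qpoch q q n / qpoch (q ^ (N - n + 1)) q n"
  define X where "X = q powi int x"
  define M where "M = q ^ Suc N"
  define Z where "Z = q ^ n"
  have nz: "X \<noteq> 0" "M \<noteq> 0" "Z \<noteq> 0" "1 - M \<noteq> 0"
    using r(1) r(2)[of N] by (auto simp: X_def M_def Z_def)
  have IH: "r_fun n \<alpha> \<beta> \<delta> N q y = \<kappa> * G (int y)" if "y \<le> N" for y
    unfolding G_def \<kappa>_def f_def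
    by (rule step.IH[OF regular_antimono[OF step.prems(1)] that]) simp
  have "raising \<delta> q N (r_fun n \<alpha> \<beta> \<delta> N q) x
      = \<kappa> * (raise_u \<delta> q N x * G (int x) + raise_v \<delta> q N x * G (int x - 1))"
  proof (cases x)
    \<comment> \<open>The kernel is evaluated at x = -1 here, with the coefficient v(0) = 0.\<close>
    case 0
    then show ?thesis by (simp add: raising_0 raise_v_0 IH)
  next
    case (Suc y)
    have y: "y \<le> N" using Suc step.prems by simp
    \<comment> \<open>At \<open>x = Suc N\<close> the induction hypothesis says nothing, but u
      vanishes there.\<close>
    have "raise_u \<delta> q N x * r_fun n \<alpha> \<beta> \<delta> N q x = raise_u \<delta> q N x * (\<kappa> * G (int x))"
      using step.prems(2) r(1) by (cases "x = Suc N") (auto simp: raise_u_top IH)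
    moreover have "int x - 1 = int y" by (simp add: Suc)
    ultimately show ?thesis
      using raising_Suc[OF r(1) y, of \<delta>] IH[OF y] by (simp add: Suc algebra_simps)
  qed
  also have "raise_u \<delta> q N x * G (int x) + raise_v \<delta> q N x * G (int x - 1)
      = (\<Sum>y\<le>n. (raise_u \<delta> q N x * raise_kernel \<delta> q n N (int x) y
          + raise_v \<delta> q N x * raise_kernel \<delta> q n N (int x - 1) y) * f y)"
    unfolding G_def sum_distrib_left sum.distrib[symmetric]
    by (rule sum.cong) (simp_all add: algebra_simps)
  also have "\<dots> = (\<Sum>y\<le>n. (1 - M / Z) / M * (raise_kernel \<delta> q n (Suc N) (int x) y * f y))"
  proof (rule sum.cong)
    fix y assume y: "y \<in> {..n}"
    have p1: "q powi (int x - int N - 1) = X / M"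
      unfolding X_def M_def power_int_of_nat by (rule powi_nat_diff) (use r in auto)
    have p2: "q powi (2 * int x - int N - 1) = X\<^sup>2 / M"
      unfolding X_def M_def power_int_of_nat power_mult[symmetric]
      by (rule powi_nat_diff) (use r in auto)
    have p3: "q powi (- int N - 1) = 1 / M"
      unfolding M_def using powi_nat_diff[of q "- int N - 1" 0 "Suc N"] r by simp
    have d: "1 - \<delta> * (X\<^sup>2 / M) \<noteq> 0"
      using r(4)[of "2 * int x - int N - 1"] step.prems(2) by (simp add: p2)
    define D where "D = 1 - \<delta> * (X\<^sup>2 / M)"
    define k1 where "k1 = raise_kernel \<delta> q n N (int x) y"
    define k2 where "k2 = raise_kernel \<delta> q n N (int x - 1) y"
    have u: "raise_u \<delta> q N x = - M * (1 - X / M) * (1 - \<delta> * (X / M)) / (M * D)"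
      unfolding raise_u_def p1 p2 D_def using nz by simp
    have v: "raise_v \<delta> q N x = (1 - X) * (1 - \<delta> * X) / (M * D)"
      unfolding raise_v_def p2 p3 D_def X_def by simp
    have "raise_u \<delta> q N x * k1 + raise_v \<delta> q N x * k2
        = (- M * (1 - X / M) * (1 - \<delta> * (X / M)) * k1 + (1 - X) * (1 - \<delta> * X) * k2) / (M * D)"
      unfolding u v by (simp add: add_divide_distrib diff_divide_distrib)
    also have "\<dots> = (1 - M / Z) * D * raise_kernel \<delta> q n (Suc N) (int x) y / (M * D)"
      unfolding k1_def k2_def X_def M_def Z_def D_def
      by (subst raise_kernel_step[OF r(1)]) (use y in auto)
    also have "\<dots> = (1 - M / Z) / M * raise_kernel \<delta> q n (Suc N) (int x) y"
      using d[folded D_def] nz(2) by simp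
    finally show "(raise_u \<delta> q N x * raise_kernel \<delta> q n N (int x) y
          + raise_v \<delta> q N x * raise_kernel \<delta> q n N (int x - 1) y) * f y
        = (1 - M / Z) / M * (raise_kernel \<delta> q n (Suc N) (int x) y * f y)"
      by (simp add: k1_def k2_def)
  qed simp
  finally have R: "raising \<delta> q N (r_fun n \<alpha> \<beta> \<delta> N q) x = \<kappa> * ((1 - M / Z) / M
      * (\<Sum>y\<le>n. raise_kernel \<delta> q n (Suc N) (int x) y * f y))"
    by (simp only: sum_distrib_left)
  have e: "N - n + 1 + n = Suc N" "Suc N - n = N - n + 1" using step.hyps by simp_all
  define c where "c = q ^ (N - n + 1)"
  have cZ: "c * Z = M" unfolding c_def Z_def M_def power_add[symmetric] e ..
  have c0: "1 - c \<noteq> 0" using r(2)[of "N - n"] by (simp add: c_def)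
  \<comment> \<open>Splitting (c; q)_(n+1) at both ends leads from the prefactor (q^(N-n+1); q)_n to
    (q^(N-n+2); q)_n. The extra factors 1 - c and 1 - M cancel against the kernel recursion and the
    normalisation of one step.\<close>
  have "qpoch c q (Suc n) = qpoch c q n * (1 - M)" unfolding qpoch_Suc cZ[symmetric] Z_def ..
  then have shift: "qpoch c q n = (1 - c) * qpoch (c * q) q n / (1 - M)"
    using nz(4) by (simp add: qpoch_Suc_shift)
  have cq: "q ^ (Suc N - n + 1) = c * q" unfolding e c_def by simp
  have "M / Z = c" unfolding cZ[symmetric] using nz(3) by simp
  then have "M / (1 - M) * (\<kappa> * ((1 - M / Z) / M)) = qpoch q q n / qpoch (c * q) q n"
    unfolding \<kappa>_def c_def[symmetric] shift using c0 nz by simp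
  then show ?case
    unfolding r_fun_Suc[OF step.hyps(1)] R M_def[symmetric] f_def[symmetric] cq
    by (metis (no_types, lifting) mult.assoc)
qed

section \<open>Behaviour under complex conjugation\<close>

lemma cnj_qpoch: "cnj (qpoch a q k) = qpoch (cnj a) (cnj q) k"
  by (simp add: qpoch_def)

lemma cnj_raising: "cnj (raising \<delta> q k f x) = raising (cnj \<delta>) (cnj q) k (\<lambda>y. cnj (f y)) x"
  by (simp add: raising_def val_def)

lemma cnj_r_diag: "cnj (r_diag n \<alpha> \<beta> \<delta> q x) = r_diag n (cnj \<alpha>) (cnj \<beta>) (cnj \<delta>) (cnj q) x"
  by (simp add: r_diag_def cnj_qpoch)

text \<open>All ingredients are rational in q and the parameters with rational coefficients. For
  real parameters r_n is therefore real, which removes the conjugation from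
  \<open>inner_V\<close>.\<close>

lemma cnj_r_fun:
  assumes "n \<le> N"
  shows "cnj (r_fun n \<alpha> \<beta> \<delta> N q x) = r_fun n (cnj \<alpha>) (cnj \<beta>) (cnj \<delta>) N (cnj q) x"
proof -
  have "cnj (fold (raising \<delta> q) [n..<N] (r_diag n \<alpha> \<beta> \<delta> q) x)
    = fold (raising (cnj \<delta>) (cnj q)) [n..<N] (r_diag n (cnj \<alpha>) (cnj \<beta>) (cnj \<delta>) (cnj q)) x"
    using assms by (induction N arbitrary: x rule: dec_induct) (simp_all add: cnj_r_diag cnj_raising)
  then show ?thesis by (simp add: r_fun_def cnj_qpoch)
qed

theorem theorem6p1:
  fixes q0 :: real and q \<alpha> \<beta> \<delta> :: complex and n N :: nat
  assumes "0 < q0" and "q0 < 1" and "q = complex_of_real q0"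
    and "n \<le> N"
    and "\<alpha> \<noteq> 0" and "\<beta> \<noteq> 0" and "\<delta> \<noteq> 0"
    and "\<forall>j\<in>{1..N}. \<alpha> * q ^ j \<noteq> 1"
    and "\<forall>j\<in>{1..N}. \<beta> * \<delta> * q ^ j \<noteq> 1"
    and "\<forall>j::int. \<bar>j\<bar> \<le> int N \<longrightarrow> \<delta> * q powi j \<noteq> 1"
  shows
    "(\<forall>x\<le>N. r_fun n \<alpha> \<beta> \<delta> N q x =
        qpoch q q n / qpoch (q ^ (N - n + 1)) q n *
        (\<Sum>y = nat (max (int x - int N + int n) 0)..min x n.
           qbinom q (N - x) (n - y) * qbinom q x y
           * (qpoch (\<delta> * q powi (int x - int N)) q y
              * qpoch (\<delta> * q powi (int x - int n + int y + 1)) q (n - y)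
              / qpoch (\<delta> * q powi (int y - int n)) q (n + 1))
           * (1 - \<delta> * q powi (2 * int y - int n))
           * q powi (int y * (int y + int N - int x - int n))
           * (\<alpha> * \<beta> * q ^ (n + 1)) ^ y
           * (qpoch (inverse \<alpha> * \<delta> * q powi (- int n)) q y * qpoch (inverse \<beta> * q powi (- int n)) q y
              / (qpoch (\<alpha> * q) q y * qpoch (\<beta> * \<delta> * q) q y))))
   \<and> (\<forall>x\<le>N. racah_op \<alpha> \<beta> \<delta> N q (r_fun n \<alpha> \<beta> \<delta> N q) x =
        q powi (- int n) * (1 - q ^ n) * (1 - \<alpha> * \<beta> * q ^ (n + 1)) * r_fun n \<alpha> \<beta> \<delta> N q x)
   \<and> (\<alpha> * \<beta> * q ^ (2 * n + 1) \<noteq> 1 \<longrightarrow>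
      (\<forall>m\<le>N.
        let rhs = (if n = m then 1 else 0) * q ^ (N * (N + 1) div 2) * (\<delta> * q powi (- int N)) ^ n
              * (qpoch (\<alpha> * \<beta> * q ^ (n + 1)) q (N + 1)
                 * (qpoch q q n * qpoch (\<alpha> * inverse \<delta> * q) q n * qpoch (\<beta> * q) q n))
              / ((1 - \<alpha> * \<beta> * q ^ (2 * n + 1)) * qpoch q q N
                 * (qpoch (q powi (- int N)) q n * qpoch (\<beta> * \<delta> * q) q n * qpoch (\<alpha> * q) q n))
        in (\<alpha> \<in> \<real> \<and> \<beta> \<in> \<real> \<and> \<delta> \<in> \<real> \<longrightarrow>
              inner_V \<alpha> \<beta> \<delta> N q (r_fun n \<alpha> \<beta> \<delta> N q) (r_fun m \<alpha> \<beta> \<delta> N q) = rhs)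
         \<and> inner_V \<alpha> \<beta> \<delta> N q (r_fun n \<alpha> \<beta> \<delta> N q) (\<lambda>x. cnj (r_fun m \<alpha> \<beta> \<delta> N q x)) = rhs))"
proof -
  have reg: "regular \<delta> q N"
    unfolding regular_def
  proof (intro conjI allI)
    show "q \<noteq> 0" using assms by simp
    show "q ^ Suc j \<noteq> 1" for j
    proof -
      have "q0 ^ Suc j \<noteq> 1" using power_less_one_iff[of q0 "Suc j"] assms by simp
      then show ?thesis using assms(3) by (metis of_real_1 of_real_eq_iff of_real_power)
    qed
  qed (use assms in auto)
  have adm: "admissible \<alpha> \<beta> \<delta> q N" using assms unfolding admissible_def by blast
  note r = regularD[OF reg]
  have explicit: "r_fun n \<alpha> \<beta> \<delta> N q x =
        qpoch q q n / qpoch (q ^ (N - n + 1)) q n *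
        (\<Sum>y = nat (max (int x - int N + int n) 0)..min x n.
           qbinom q (N - x) (n - y) * qbinom q x y
           * (qpoch (\<delta> * q powi (int x - int N)) q y
              * qpoch (\<delta> * q powi (int x - int n + int y + 1)) q (n - y)
              / qpoch (\<delta> * q powi (int y - int n)) q (n + 1))
           * (1 - \<delta> * q powi (2 * int y - int n))
           * q powi (int y * (int y + int N - int x - int n))
           * (\<alpha> * \<beta> * q ^ (n + 1)) ^ y
           * (qpoch (inverse \<alpha> * \<delta> * q powi (- int n)) q y * qpoch (inverse \<beta> * q powi (- int n)) q y
              / (qpoch (\<alpha> * q) q y * qpoch (\<beta> * \<delta> * q) q y)))"
    if x: "x \<le> N" for x
  proof -
    let ?I = "{nat (max (int x - int N + int n) 0)..min x n}"
    have Nx: "int N - int x = int (N - x)" using x by simp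
    have "(\<Sum>y\<le>n. raise_kernel \<delta> q n N (int x) y * r_diag n \<alpha> \<beta> \<delta> q y)
        = (\<Sum>y\<in>?I. raise_kernel \<delta> q n N (int x) y * r_diag n \<alpha> \<beta> \<delta> q y)"
    proof (rule sum.mono_neutral_right)
      show "\<forall>y\<in>{..n} - ?I. raise_kernel \<delta> q n N (int x) y * r_diag n \<alpha> \<beta> \<delta> q y = 0"
      proof
        fix y assume "y \<in> {..n} - ?I"
        \<comment> \<open>Below the lower limit N - x < n - y, above the upper one x < y: in either
          case one binomial vanishes.\<close>
        then have "x < y \<or> N - x < n - y" using x by auto
        then have "qbinom_int q (int N - int x) (n - y) = 0 \<or> qbinom_int q (int x) y = 0"
          unfolding Nx using qbinom_int_eq_0[OF r(1)] by blast
        then show "raise_kernel \<delta> q n N (int x) y * r_diag n \<alpha> \<beta> \<delta> q y = 0"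
          by (auto simp: raise_kernel_def)
      qed
    qed auto
    also have "\<dots> = (\<Sum>y\<in>?I. qbinom q (N - x) (n - y) * qbinom q x y
           * (qpoch (\<delta> * q powi (int x - int N)) q y
              * qpoch (\<delta> * q powi (int x - int n + int y + 1)) q (n - y)
              / qpoch (\<delta> * q powi (int y - int n)) q (n + 1))
           * (1 - \<delta> * q powi (2 * int y - int n))
           * q powi (int y * (int y + int N - int x - int n))
           * (\<alpha> * \<beta> * q ^ (n + 1)) ^ y
           * (qpoch (inverse \<alpha> * \<delta> * q powi (- int n)) q y * qpoch (inverse \<beta> * q powi (- int n)) q y
              / (qpoch (\<alpha> * q) q y * qpoch (\<beta> * \<delta> * q) q y)))"
    proof (rule sum.cong)
      fix y assume "y \<in> ?I"
      \<comment> \<open>On this range the upper indices dominate the lower ones, so the truncated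
        subtraction in \<open>qbinom\<close> is exact.\<close>
      then have y: "y \<le> x" "n - y \<le> N - x" using x by auto
      show "raise_kernel \<delta> q n N (int x) y * r_diag n \<alpha> \<beta> \<delta> q y
        = qbinom q (N - x) (n - y) * qbinom q x y
           * (qpoch (\<delta> * q powi (int x - int N)) q y
              * qpoch (\<delta> * q powi (int x - int n + int y + 1)) q (n - y)
              / qpoch (\<delta> * q powi (int y - int n)) q (n + 1))
           * (1 - \<delta> * q powi (2 * int y - int n))
           * q powi (int y * (int y + int N - int x - int n))
           * (\<alpha> * \<beta> * q ^ (n + 1)) ^ y
           * (qpoch (inverse \<alpha> * \<delta> * q powi (- int n)) q y * qpoch (inverse \<beta> * q powi (- int n)) q y
              / (qpoch (\<alpha> * q) q y * qpoch (\<beta> * \<delta> * q) q y))"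
        unfolding raise_kernel_def r_diag_def Nx qbinom_int_eq[OF y(1)] qbinom_int_eq[OF y(2)]
        by (simp only: mult.assoc times_divide_eq_right)
    qed simp
    finally show ?thesis by (simp only: r_fun_eq_kernel_sum[OF assms(4) reg x])
  qed
  have difference: "racah_op \<alpha> \<beta> \<delta> N q (r_fun n \<alpha> \<beta> \<delta> N q) x =
        q powi (- int n) * (1 - q ^ n) * (1 - \<alpha> * \<beta> * q ^ (n + 1)) * r_fun n \<alpha> \<beta> \<delta> N q x"
    if "x \<le> N" for x
    using racah_op_r_fun[OF assms(4) reg admissible_antimono[OF adm assms(4)] that]
    by (simp only: racah_eigenvalue_def)
  have inner: "bilinear_V \<alpha> \<beta> \<delta> N q (r_fun n \<alpha> \<beta> \<delta> N q) (r_fun m \<alpha> \<beta> \<delta> N q)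
      = (if n = m then 1 else 0) * racah_norm \<alpha> \<beta> \<delta> N q n"
    if m: "m \<le> N" and deg: "\<alpha> * \<beta> * q ^ (2 * n + 1) \<noteq> 1" for m
  proof (cases n m rule: linorder_cases)
    case less
    then show ?thesis
      using bilinear_V_r_fun_less[OF less m reg adm] by (subst bilinear_V_commute) simp
  next
    case equal
    then show ?thesis using r_fun_norm[OF assms(4) reg adm deg] by simp
  next
    case greater
    then show ?thesis using bilinear_V_r_fun_less[OF greater assms(4) reg adm] by simp
  qed
  \<comment> \<open>The conjugate in the second argument cancels that of \<open>inner_V\<close>;
    this gives the relation for complex parameters.\<close>
  have bil: "inner_V \<alpha> \<beta> \<delta> N q f (\<lambda>x. cnj (g x)) = bilinear_V \<alpha> \<beta> \<delta> N q f g" for f g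
    by (simp add: inner_V_def bilinear_V_def atMost_atLeast0)
  have cnj_r: "cnj (r_fun m \<alpha> \<beta> \<delta> N q x) = r_fun m \<alpha> \<beta> \<delta> N q x"
    if "\<alpha> \<in> \<real>" "\<beta> \<in> \<real>" "\<delta> \<in> \<real>" "m \<le> N" "x \<le> N" for m x
    using that assms(3) by (simp add: cnj_r_fun Reals_cnj_iff)
  have bil_real: "inner_V \<alpha> \<beta> \<delta> N q (r_fun n \<alpha> \<beta> \<delta> N q) (r_fun m \<alpha> \<beta> \<delta> N q)
      = bilinear_V \<alpha> \<beta> \<delta> N q (r_fun n \<alpha> \<beta> \<delta> N q) (r_fun m \<alpha> \<beta> \<delta> N q)"
    if "\<alpha> \<in> \<real>" "\<beta> \<in> \<real>" "\<delta> \<in> \<real>" "m \<le> N" for m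
    unfolding inner_V_def bilinear_V_def atMost_atLeast0
    by (rule sum.cong) (simp_all add: cnj_r that)
  show ?thesis
    unfolding Let_def
  proof (intro conjI allI impI)
    fix m assume deg: "\<alpha> * \<beta> * q ^ (2 * n + 1) \<noteq> 1" and m: "m \<le> N"
    let ?rhs = "(if n = m then 1 else 0) * q ^ (N * (N + 1) div 2) * (\<delta> * q powi (- int N)) ^ n
      * (qpoch (\<alpha> * \<beta> * q ^ (n + 1)) q (N + 1)
         * (qpoch q q n * qpoch (\<alpha> * inverse \<delta> * q) q n * qpoch (\<beta> * q) q n))
      / ((1 - \<alpha> * \<beta> * q ^ (2 * n + 1)) * qpoch q q N
         * (qpoch (q powi (- int N)) q n * qpoch (\<beta> * \<delta> * q) q n * qpoch (\<alpha> * q) q n))"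
    have norm: "bilinear_V \<alpha> \<beta> \<delta> N q (r_fun n \<alpha> \<beta> \<delta> N q) (r_fun m \<alpha> \<beta> \<delta> N q) = ?rhs"
      unfolding inner[OF m deg] racah_norm_def times_divide_eq_right by (simp only: mult.assoc)
    show "inner_V \<alpha> \<beta> \<delta> N q (r_fun n \<alpha> \<beta> \<delta> N q) (\<lambda>x. cnj (r_fun m \<alpha> \<beta> \<delta> N q x)) = ?rhs"
      unfolding bil by (rule norm)
    show "inner_V \<alpha> \<beta> \<delta> N q (r_fun n \<alpha> \<beta> \<delta> N q) (r_fun m \<alpha> \<beta> \<delta> N q) = ?rhs"
      if "\<alpha> \<in> \<real> \<and> \<beta> \<in> \<real> \<and> \<delta> \<in> \<real>"
      using norm bil_real[of m] m that by (simp only:)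
  qed (rule explicit difference; assumption)+
qed

end
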